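(* Let $A,B\in\widehat{\mathbb Q}^{m\times m}$ be Hermitian. Then $$\mathrm{trace}(AB+BA)\le 2\sum_{i=1}^m\lambda_i(A)\lambda_i(B),$$ where $\lambda_1(A)\ge\lambda_2(A)\ge\cdots\ge\lambda_m(A)$ and $\lambda_1(B)\ge\lambda_2(B)\ge\cdots\ge\lambda_m(B)$ are the eigenvalues of $A$ and $B$, respectively, and $\le$ is the total order on dual numbers. In particular, the inequality $\mathrm{trace}(AB+BA)\le 2\sum_{i=1}^m\lambda_i(A)\lambda_i(B)$ holds when $A,B\in\mathbb Q^{m\times m}$ are Hermitian quaternion matrices.
   Context: Dual numbers: $\widehat{\mathbb R}=\{q_{\sf st}+q_{\sf in}\epsilon: q_{\sf st},q_{\sf in}\in\mathbb R\}$ with $\epsilon\neq 0$, $\epsilon^2=0$, is a commutative ring, totally ordered by: $q<p$ iff $q_{\sf st}<p_{\sf st}$, or $q_{\sf st}=p_{\sf st}$ and $q_{\sf in}<p_{\sf in}$. Dual quaternions: let $\mathbb Q$ be the real quaternions. $\widehat{\mathbb Q}=\{q_{\sf st}+q_{\sf in}\epsilon: q_{\sf st},q_{\sf in}\in\mathbb Q\}$, where $\epsilon$ commutes with quaternions and $\epsilon^2=0$. The conjugate is $\bar q=\bar q_{\sf st}+\bar q_{\sf in}\epsilon$. Matrices: for $A=(a_{ij})\in\widehat{\mathbb Q}^{m\times n}$, $A=A_{\sf st}+A_{\sf in}\epsilon$ with $A_{\sf st},A_{\sf in}\in\mathbb Q^{m\times n}$, and $A^*=(\bar a_{ji})$.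 A square matrix $A$ is Hermitian if $A^*=A$; a square matrix $U$ is unitary if $U^*U=UU^*=I$. For a square matrix, $\mathrm{trace}(A)=\sum_i a_{ii}$; for a Hermitian matrix it is a dual number. A vector is appreciable if its standard part is nonzero. Eigenvalues: $\lambda\in\widehat{\mathbb Q}$ is a right eigenvalue of $A\in\widehat{\mathbb Q}^{m\times m}$ if $A\mathbf x=\mathbf x\lambda$ for some appreciable $\mathbf x\in\widehat{\mathbb Q}^m$; if $\lambda$ is a dual number it is simply called an eigenvalue. It is known that for Hermitian $A\in\widehat{\mathbb Q}^{m\times m}$ there is a unitary $U\in\widehat{\mathbb Q}^{m\times m}$ with $A=U\,\mathrm{diag}(\lambda_1(A),\dots,\lambda_m(A))\,U^*$, where $\lambda_1(A)\ge\cdots\ge\lambda_m(A)$ are dual numbers uniquely determined by $A$ (with multiplicity); these are the $m$ eigenvalues of $A$. For a Hermitian quaternion matrix they are real. *)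

theory Defs
  imports Complex_Main "Jordan_Normal_Form.Matrix"
begin

section \<open>Rings with an involution\<close>

class involutive_ring = ring_1 +
  fixes invol :: "'a \<Rightarrow> 'a"
  assumes invol_add: "invol (x + y) = invol x + invol y"
    and invol_mult: "invol (x * y) = invol y * invol x"
    and invol_invol: "invol (invol x) = x"


section \<open>Real quaternions\<close>

datatype quat = Quat (quat_re: real) (quat_i: real) (quat_j: real) (quat_k: real)

lemma quat_eq_iff:
  "x = y \<longleftrightarrow> quat_re x = quat_re y \<and> quat_i x = quat_i y \<and> quat_j x = quat_j y \<and> quat_k x = quat_k y"
  by (cases x; cases y) simp

instantiation quat :: "{real_algebra_1, involutive_ring}"
begin

definition zero_quat :: quat where
  "0 = Quat 0 0 0 0"

definition one_quat :: quat where
  "1 = Quat 1 0 0 0"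

definition plus_quat :: "quat \<Rightarrow> quat \<Rightarrow> quat" where
  "x + y = Quat (quat_re x + quat_re y) (quat_i x + quat_i y) (quat_j x + quat_j y) (quat_k x + quat_k y)"

definition uminus_quat :: "quat \<Rightarrow> quat" where
  "- x = Quat (- quat_re x) (- quat_i x) (- quat_j x) (- quat_k x)"

definition minus_quat :: "quat \<Rightarrow> quat \<Rightarrow> quat" where
  "x - y = Quat (quat_re x - quat_re y) (quat_i x - quat_i y) (quat_j x - quat_j y) (quat_k x - quat_k y)"

definition times_quat :: "quat \<Rightarrow> quat \<Rightarrow> quat" where
  "x * y = Quat
    (quat_re x * quat_re y - quat_i x * quat_i y - quat_j x * quat_j y - quat_k x * quat_k y)
    (quat_re x * quat_i y + quat_i x * quat_re y + quat_j x * quat_k y - quat_k x * quat_j y)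
    (quat_re x * quat_j y - quat_i x * quat_k y + quat_j x * quat_re y + quat_k x * quat_i y)
    (quat_re x * quat_k y + quat_i x * quat_j y - quat_j x * quat_i y + quat_k x * quat_re y)"

definition scaleR_quat :: "real \<Rightarrow> quat \<Rightarrow> quat" where
  "scaleR r x = Quat (r * quat_re x) (r * quat_i x) (r * quat_j x) (r * quat_k x)"

definition invol_quat :: "quat \<Rightarrow> quat" where
  "invol x = Quat (quat_re x) (- quat_i x) (- quat_j x) (- quat_k x)"

instance
  by standard
    (simp_all add: quat_eq_iff zero_quat_def one_quat_def plus_quat_def uminus_quat_def
      minus_quat_def times_quat_def scaleR_quat_def invol_quat_def algebra_simps)

end


section \<open>Dual numbers over a ring\<close>

text \<open>
  \<open>Dual a b\<close> stands for \<open>a + b \<epsilon>\<close>, where \<open>\<epsilon>\<close> is central and \<open>\<epsilon>\<^sup>2 = 0\<close>. The dual numbers are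
  \<^typ>\<open>real\<close> \<open>dual\<close>, the dual quaternions are \<^typ>\<open>quat\<close> \<open>dual\<close>.
\<close>

datatype 'a dual = Dual (std_part: 'a) (inf_part: 'a)

lemma dual_eq_iff:
  "x = y \<longleftrightarrow> std_part x = std_part y \<and> inf_part x = inf_part y"
  by (cases x; cases y) simp

instantiation dual :: (ring_1) ring_1
begin

definition zero_dual :: "'a dual" where
  "0 = Dual 0 0"

definition one_dual :: "'a dual" where
  "1 = Dual 1 0"

definition plus_dual :: "'a dual \<Rightarrow> 'a dual \<Rightarrow> 'a dual" where
  "x + y = Dual (std_part x + std_part y) (inf_part x + inf_part y)"

definition uminus_dual :: "'a dual \<Rightarrow> 'a dual" where
  "- x = Dual (- std_part x) (- inf_part x)"

definition minus_dual :: "'a dual \<Rightarrow> 'a dual \<Rightarrow> 'a dual" where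
  "x - y = Dual (std_part x - std_part y) (inf_part x - inf_part y)"

definition times_dual :: "'a dual \<Rightarrow> 'a dual \<Rightarrow> 'a dual" where
  "x * y = Dual (std_part x * std_part y) (std_part x * inf_part y + inf_part x * std_part y)"

instance
  by standard
    (simp_all add: dual_eq_iff zero_dual_def one_dual_def plus_dual_def uminus_dual_def
      minus_dual_def times_dual_def algebra_simps)

end

instance dual :: (comm_ring_1) comm_ring_1
  by standard
    (simp_all add: dual_eq_iff one_dual_def plus_dual_def times_dual_def algebra_simps)

instantiation dual :: (linorder) linorder
begin

definition less_dual :: "'a dual \<Rightarrow> 'a dual \<Rightarrow> bool" where
  "x < y \<longleftrightarrow> std_part x < std_part y \<or> std_part x = std_part y \<and> inf_part x < inf_part y"

definition less_eq_dual :: "'a dual \<Rightarrow> 'a dual \<Rightarrow> bool" where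
  "x \<le> y \<longleftrightarrow> x < y \<or> x = (y :: 'a dual)"

instance
  by standard (auto simp: less_eq_dual_def less_dual_def dual_eq_iff)

end

instantiation dual :: (involutive_ring) involutive_ring
begin

definition invol_dual :: "'a dual \<Rightarrow> 'a dual" where
  "invol x = Dual (invol (std_part x)) (invol (inf_part x))"

instance
  by standard
    (simp_all add: dual_eq_iff plus_dual_def times_dual_def invol_dual_def invol_add invol_mult
      invol_invol add.commute)

end

text \<open>The inclusion of the dual numbers into the dual quaternions.\<close>

definition quat_of_dual :: "real dual \<Rightarrow> quat dual" where
  "quat_of_dual x = Dual (of_real (std_part x)) (of_real (inf_part x))"


section \<open>Matrices and eigenvalues\<close>

definition adjoint_mat :: "'a :: involutive_ring mat \<Rightarrow> 'a mat" where
  "adjoint_mat A = mat (dim_col A) (dim_row A) (\<lambda>(i, j). invol (A $$ (j, i)))"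

definition hermitian_mat :: "'a :: involutive_ring mat \<Rightarrow> bool" where
  "hermitian_mat A \<longleftrightarrow> square_mat A \<and> adjoint_mat A = A"

definition unitary_mat :: "'a :: involutive_ring mat \<Rightarrow> bool" where
  "unitary_mat U \<longleftrightarrow> square_mat U \<and>
     adjoint_mat U * U = 1\<^sub>m (dim_row U) \<and> U * adjoint_mat U = 1\<^sub>m (dim_row U)"

definition trace_mat :: "'a :: comm_monoid_add mat \<Rightarrow> 'a" where
  "trace_mat A = (\<Sum>i<dim_row A. A $$ (i, i))"

text \<open>
  \<open>eigvals \<iota> A\<close> is the list \<open>[\<lambda>\<^sub>1(A), \<dots>, \<lambda>\<^sub>m(A)]\<close> of all eigenvalues of the Hermitian matrix \<open>A\<close>,
  in nonincreasing order and with multiplicity: the unique such list for which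
  \<open>A = U diag(\<lambda>\<^sub>1(A), \<dots>, \<lambda>\<^sub>m(A)) U\<^sup>*\<close> with \<open>U\<close> unitary. The map \<open>\<iota>\<close> is the inclusion of the ordered
  commutative ring of scalars into the ring of matrix entries (of the dual numbers into the dual
  quaternions, or of the reals into the quaternions). Lists are indexed from 0, so
  \<open>\<lambda>\<^sub>i(A)\<close> is \<open>eigvals \<iota> A ! (i - 1)\<close>.
\<close>

definition eigvals :: "('s :: linorder \<Rightarrow> 'a :: involutive_ring) \<Rightarrow> 'a mat \<Rightarrow> 's list" where
  "eigvals \<iota> A = (THE ls. length ls = dim_row A \<and> sorted_wrt (\<ge>) ls \<and>
     (\<exists>U \<in> carrier_mat (dim_row A) (dim_row A). unitary_mat U \<and>
        A = U * mat_diag (dim_row A) (\<lambda>i. \<iota> (ls ! i)) * adjoint_mat U))"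

abbreviation dual_quat_eigvals :: "quat dual mat \<Rightarrow> real dual list" where
  "dual_quat_eigvals \<equiv> eigvals quat_of_dual"

abbreviation quat_eigvals :: "quat mat \<Rightarrow> real list" where
  "quat_eigvals \<equiv> eigvals (of_real :: real \<Rightarrow> quat)"

end

theory Submission
  imports Defs "HOL-Analysis.Function_Topology"
begin

text \<open>
  Once both matrices are diagonalised, the inequality is a rearrangement inequality. Write
  \<open>A = U D U\<^sup>*\<close> and \<open>B = V E V\<^sup>*\<close> with real or dual diagonal matrices and put \<open>W = U\<^sup>* V\<close>. Since
  \<open>B A = (A B)\<^sup>*\<close>, the trace of \<open>A B + B A\<close> is twice the real part of the trace of \<open>A B\<close>. Quaternions do
  not commute, but the real part of a product does not depend on the order of its two factors, so
  that this real part is the sum of \<open>\<lambda>\<^sub>i(A) \<lambda>\<^sub>j(B) \<bar>W\<^sub>i\<^sub>j\<bar>\<^sup>2\<close> over all \<open>i\<close> and \<open>j\<close>. The squared moduli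
  form a doubly stochastic matrix, and a doubly stochastic matrix pairs two nonincreasing sequences
  at most as well as the identity does (\<open>doubly_stochastic_rearrangement\<close>). The dual numbers are an
  ordered commutative ring with zero divisors; the argument uses no division and no strict
  monotonicity, and thus applies to them and to the reals alike (locale \<open>scalar_part\<close>).

  The eigenvalue lists of the statement are defined by a definite description, so the spectral theorem
  is a part of the proof. Uniqueness comes from the same inequality: if \<open>A\<close> is diagonalised in two
  ways, each diagonal is the image of the other under a doubly stochastic matrix, so the partial sums
  of each list bound those of the other (\<open>partial_sums_le\<close>).

  Existence is a variational argument. Among all unitary quaternion matrices \<open>U\<close>, which form a compact
  set, first maximise a weighted sum, with strictly decreasing weights, of the diagonal entries of
  \<open>U\<^sup>* A\<^sub>s\<^sub>t U\<close>, and then, among the maximisers, the same weighted sum for \<open>U\<^sup>* A\<^sub>i\<^sub>n U\<close>. A rotation in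
  a coordinate plane changes the weighted sum by an explicit quadratic expression. At a maximum this
  forces the standard part to be diagonal with nonincreasing entries; inside each of its eigenspaces
  rotations leave the first sum unchanged, which forces the same for the infinitesimal part there. The
  entries of the infinitesimal part between different eigenvalues \<open>d\<^sub>i\<close> and \<open>d\<^sub>j\<close> remain; they are removed by
  replacing \<open>U\<close> by \<open>U (I + P \<epsilon>)\<close> with \<open>P\<close> skew-Hermitian (\<open>dual_quat_spectral_decomposition\<close>). A
  quaternion matrix is the standard part of a dual one, and inherits its decomposition.
\<close>

section \<open>Weighted averages in an ordered commutative ring\<close>

lemma sum_lessThan_split:
  fixes f :: "nat \<Rightarrow> 'a::comm_monoid_add"
  assumes "k \<le> m"
  shows "(\<Sum>i<m. f i) = (\<Sum>i<k. f i) + (\<Sum>i=k..<m. f i)"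
  using assms by (metis sum.atLeastLessThan_concat atLeast0LessThan zero_le)

text \<open>
  Summing each row over the first \<open>k\<close> columns gives weights between 0 and 1 with total \<open>k\<close>. Among all
  such weights, those that select the first \<open>k\<close> terms give a nonincreasing sequence its largest
  weighted sum.
\<close>
lemma doubly_stochastic_partial_sum_le:
  fixes x :: "nat \<Rightarrow> 'a::{linorder, ordered_comm_ring, comm_ring_1}"
  assumes mono: "\<And>i j. i \<le> j \<Longrightarrow> j < m \<Longrightarrow> x j \<le> x i"
    and nonneg: "\<And>i j. i < m \<Longrightarrow> j < m \<Longrightarrow> 0 \<le> s i j"
    and row: "\<And>i. i < m \<Longrightarrow> (\<Sum>j<m. s i j) = 1"
    and col: "\<And>j. j < m \<Longrightarrow> (\<Sum>i<m. s i j) = 1"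
    and k: "k \<le> m"
  shows "(\<Sum>j<k. \<Sum>i<m. x i * s i j) \<le> (\<Sum>i<k. x i)"
proof (cases "k = m")
  case True
  have "(\<Sum>j<m. \<Sum>i<m. x i * s i j) = (\<Sum>i<m. x i * (\<Sum>j<m. s i j))"
    by (subst sum.swap) (simp add: sum_distrib_left)
  also have "\<dots> = (\<Sum>i<m. x i)"
    by (simp add: row)
  finally show ?thesis
    using True by simp
next
  case False
  with k have km: "k < m" by simp
  define t where "t i = (\<Sum>j<k. s i j)" for i
  have t_nonneg: "0 \<le> t i" if "i < m" for i
    unfolding t_def by (rule sum_nonneg) (use nonneg that km in auto)
  have t_le: "t i \<le> 1" if "i < m" for i
  proof -
    have "1 = t i + (\<Sum>j=k..<m. s i j)"
      using row[OF that] sum_lessThan_split[OF k, of "s i"] by (simp add: t_def)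
    moreover have "0 \<le> (\<Sum>j=k..<m. s i j)"
      by (rule sum_nonneg) (use nonneg that in auto)
    ultimately show ?thesis
      by (metis add.right_neutral add_left_mono)
  qed
  have t_sum: "(\<Sum>i<m. t i) = (\<Sum>i<k. 1)"
    unfolding t_def by (subst sum.swap) (use col km in \<open>auto intro!: sum.cong\<close>)
  have L: "(\<Sum>j<k. \<Sum>i<m. x i * s i j) = (\<Sum>i<m. x i * t i)"
    unfolding t_def by (subst sum.swap) (simp add: sum_distrib_left)
  \<comment> \<open>The weights \<open>t\<close> and the indicator of the first \<open>k\<close> indices have the same total, so that
    subtracting the constant \<open>x k\<close> from every value does not change the difference of the sums.\<close>
  have "(\<Sum>i<m. x i * t i) - (\<Sum>i<k. x i)
      = (\<Sum>i<m. (x i - x k) * t i) - (\<Sum>i<k. x i - x k)"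
  proof -
    have "(\<Sum>i<m. (x i - x k) * t i) = (\<Sum>i<m. x i * t i) - x k * (\<Sum>i<m. t i)"
      by (simp add: left_diff_distrib sum_subtractf sum_distrib_left)
    moreover have "(\<Sum>i<k. x i - x k) = (\<Sum>i<k. x i) - x k * (\<Sum>i<k. 1)"
      by (simp add: sum_subtractf mult.commute)
    ultimately show ?thesis using t_sum by simp
  qed
  also have "\<dots> = (\<Sum>i<k. (x i - x k) * (t i - 1)) + (\<Sum>i=k..<m. (x i - x k) * t i)"
    by (simp add: sum_lessThan_split[OF k] right_diff_distrib sum_subtractf)
  also have "\<dots> \<le> 0"
  proof -
    have "(\<Sum>i<k. (x i - x k) * (t i - 1)) \<le> 0"
      by (rule sum_nonpos, rule mult_nonneg_nonpos) (use mono km t_le in auto)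
    moreover have "(\<Sum>i=k..<m. (x i - x k) * t i) \<le> 0"
      by (rule sum_nonpos, rule mult_nonpos_nonneg) (use mono km t_nonneg in auto)
    ultimately show ?thesis by (rule add_nonpos_nonpos)
  qed
  finally show ?thesis using L by simp
qed

text \<open>
  Summation by parts, organised as an induction: lowering the multiplier of the partial sum reached so
  far from \<open>y k\<close> to \<open>y (Suc k)\<close> can only decrease the value, because that partial sum is nonnegative.
\<close>
lemma sum_mult_nonneg_of_partial_sums_nonneg:
  fixes y :: "nat \<Rightarrow> 'a::{linorder, ordered_comm_ring, comm_ring_1}"
  assumes mono: "\<And>i j. i \<le> j \<Longrightarrow> j < m \<Longrightarrow> y j \<le> y i"
    and partial: "\<And>k. k \<le> m \<Longrightarrow> 0 \<le> (\<Sum>j<k. e j)"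
    and total: "(\<Sum>j<m. e j) = 0"
  shows "0 \<le> (\<Sum>j<m. y j * e j)"
proof (cases m)
  case 0
  then show ?thesis by simp
next
  case (Suc n)
  have "y k * (\<Sum>j<Suc k. e j) \<le> (\<Sum>j<Suc k. y j * e j)" if "k \<le> n" for k
    using that
  proof (induction k)
    case 0
    then show ?case by simp
  next
    case (Suc k)
    have "y (Suc k) * (\<Sum>j<Suc k. e j) \<le> y k * (\<Sum>j<Suc k. e j)"
      using mono[of k "Suc k"] partial[of "Suc k"] Suc.prems \<open>m = Suc n\<close>
      by (intro mult_right_mono) (auto simp del: sum.lessThan_Suc)
    also have "\<dots> \<le> (\<Sum>j<Suc k. y j * e j)"
      using Suc by simp
    finally show ?case
      by (simp only: sum.lessThan_Suc[of _ "Suc k"] distrib_left add_right_mono)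
  qed
  from this[of n] show ?thesis
    using total Suc by simp
qed

text \<open>
  The sequence \<open>x\<close> majorises its average under \<open>s\<close>: the differences have nonnegative partial sums and
  total 0, so that multiplying them by the nonincreasing \<open>y\<close> gives a nonnegative sum.
\<close>
lemma doubly_stochastic_rearrangement:
  fixes x :: "nat \<Rightarrow> 'a::{linorder, ordered_comm_ring, comm_ring_1}"
  assumes mono_l: "\<And>i j. i \<le> j \<Longrightarrow> j < m \<Longrightarrow> x j \<le> x i"
    and mono_m: "\<And>i j. i \<le> j \<Longrightarrow> j < m \<Longrightarrow> y j \<le> y i"
    and nonneg: "\<And>i j. i < m \<Longrightarrow> j < m \<Longrightarrow> 0 \<le> s i j"
    and row: "\<And>i. i < m \<Longrightarrow> (\<Sum>j<m. s i j) = 1"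
    and col: "\<And>j. j < m \<Longrightarrow> (\<Sum>i<m. s i j) = 1"
  shows "(\<Sum>i<m. \<Sum>j<m. x i * y j * s i j) \<le> (\<Sum>i<m. x i * y i)"
proof -
  define e where "e j = x j - (\<Sum>i<m. x i * s i j)" for j
  have "0 \<le> (\<Sum>j<m. y j * e j)"
  proof (rule sum_mult_nonneg_of_partial_sums_nonneg[OF mono_m])
    show "0 \<le> (\<Sum>j<k. e j)" if "k \<le> m" for k
      using doubly_stochastic_partial_sum_le[OF mono_l nonneg row col that]
      by (simp add: e_def sum_subtractf)
    have "(\<Sum>j<m. \<Sum>i<m. x i * s i j) = (\<Sum>i<m. x i * (\<Sum>j<m. s i j))"
      by (subst sum.swap) (simp add: sum_distrib_left)
    then show "(\<Sum>j<m. e j) = 0"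
      by (simp add: e_def sum_subtractf row)
  qed
  also have "(\<Sum>j<m. y j * e j) = (\<Sum>j<m. x j * y j) - (\<Sum>j<m. \<Sum>i<m. x i * y j * s i j)"
    by (simp add: e_def right_diff_distrib sum_subtractf sum_distrib_left mult_ac)
  finally show ?thesis
    by (subst sum.swap) simp
qed


section \<open>Matrices over a ring with involution\<close>

lemma invol_zero [simp]: "invol (0 :: 'a::involutive_ring) = 0"
  using invol_add[of "0::'a" 0] by simp

lemma invol_one [simp]: "invol (1 :: 'a::involutive_ring) = 1"
  using invol_mult[of "1::'a" "invol 1"] by (simp add: invol_invol)

lemma invol_minus: "invol (- x) = - invol (x :: 'a::involutive_ring)"
  using invol_add[of x "- x"] by (simp add: eq_neg_iff_add_eq_0 add.commute)

lemma invol_diff: "invol (x - y) = invol x - invol (y :: 'a::involutive_ring)"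
  using invol_add[of x "- y"] by (simp add: invol_minus)

lemma invol_sum: "invol (\<Sum>i\<in>S. f i) = (\<Sum>i\<in>S. invol (f i :: 'a::involutive_ring))"
  by (induction S rule: infinite_finite_induct) (simp_all add: invol_add)

lemma index_mult_mat_sum:
  assumes "A \<in> carrier_mat l n" "B \<in> carrier_mat n m" "i < l" "j < m"
  shows "(A * B) $$ (i, j) = (\<Sum>k<n. A $$ (i, k) * B $$ (k, j))"
  using assms by (auto simp: scalar_prod_def atLeast0LessThan intro!: sum.cong)

lemma adjoint_carrier [simp]: "A \<in> carrier_mat n m \<Longrightarrow> adjoint_mat A \<in> carrier_mat m n"
  by (simp add: adjoint_mat_def)

lemma adjoint_dim [simp]: "dim_row (adjoint_mat A) = dim_col A" "dim_col (adjoint_mat A) = dim_row A"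
  by (simp_all add: adjoint_mat_def)

lemma adjoint_one [simp]: "adjoint_mat (1\<^sub>m m) = 1\<^sub>m m"
  by (rule eq_matI) (auto simp: adjoint_mat_def)

lemma mult_square_carrier [simp]:
  "A \<in> carrier_mat m m \<Longrightarrow> B \<in> carrier_mat m m \<Longrightarrow> A * B \<in> carrier_mat m m"
  by (rule mult_carrier_mat)

lemma adjoint_index [simp]:
  "A \<in> carrier_mat n m \<Longrightarrow> i < m \<Longrightarrow> j < n \<Longrightarrow> adjoint_mat A $$ (i, j) = invol (A $$ (j, i))"
  by (simp add: adjoint_mat_def)

lemma adjoint_adjoint [simp]: "adjoint_mat (adjoint_mat A) = A"
  by (rule eq_matI) (simp_all add: adjoint_mat_def invol_invol)

lemma adjoint_mult:
  assumes "A \<in> carrier_mat l n" "B \<in> carrier_mat n m"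
  shows "adjoint_mat (A * B) = adjoint_mat B * adjoint_mat A"
proof (rule eq_matI)
  fix i j
  assume "i < dim_row (adjoint_mat B * adjoint_mat A)" "j < dim_col (adjoint_mat B * adjoint_mat A)"
  then have "i < m" "j < l"
    using assms by (auto simp: adjoint_mat_def)
  then show "adjoint_mat (A * B) $$ (i, j) = (adjoint_mat B * adjoint_mat A) $$ (i, j)"
    using assms
    by (simp add: adjoint_index[OF mult_carrier_mat[OF assms]] index_mult_mat_sum[OF assms]
        index_mult_mat_sum[OF adjoint_carrier[OF assms(2)] adjoint_carrier[OF assms(1)]]
        invol_sum invol_mult del: index_mult_mat)
qed (use assms in \<open>auto simp: adjoint_mat_def\<close>)

lemma hermitianD:
  "hermitian_mat A \<Longrightarrow> adjoint_mat A = A"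
  by (simp add: hermitian_mat_def)

lemma unitary_iff:
  assumes "U \<in> carrier_mat m m"
  shows "unitary_mat U \<longleftrightarrow> adjoint_mat U * U = 1\<^sub>m m \<and> U * adjoint_mat U = 1\<^sub>m m"
  using assms by (auto simp: unitary_mat_def)

lemma unitary_iff_entries:
  assumes U: "U \<in> carrier_mat m m"
  shows "unitary_mat U \<longleftrightarrow> (\<forall>i<m. \<forall>j<m.
    (\<Sum>k<m. invol (U $$ (k, i)) * U $$ (k, j)) = 1\<^sub>m m $$ (i, j) \<and>
    (\<Sum>k<m. U $$ (i, k) * invol (U $$ (j, k))) = 1\<^sub>m m $$ (i, j))"
proof -
  have eq: "A = 1\<^sub>m m \<longleftrightarrow> (\<forall>i<m. \<forall>j<m. A $$ (i, j) = 1\<^sub>m m $$ (i, j))"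
    if "A \<in> carrier_mat m m" for A :: "'a mat"
    using that by (auto intro!: eq_matI)
  have left: "(adjoint_mat U * U) $$ (i, j) = (\<Sum>k<m. invol (U $$ (k, i)) * U $$ (k, j))"
    and right: "(U * adjoint_mat U) $$ (i, j) = (\<Sum>k<m. U $$ (i, k) * invol (U $$ (j, k)))"
    if "i < m" "j < m" for i j
    using that U
    by (simp_all add: index_mult_mat_sum[of _ m m _ m] adjoint_index[of _ m m] del: index_mult_mat)
  show ?thesis
    unfolding unitary_iff[OF U] eq[OF mult_square_carrier[OF adjoint_carrier[OF U] U]]
      eq[OF mult_square_carrier[OF U adjoint_carrier[OF U]]]
    by (simp add: left right del: index_mult_mat) blast
qed

lemma mult_assoc4:
  fixes A :: "'a::ring_1 mat"
  assumes "A \<in> carrier_mat m m" "B \<in> carrier_mat m m" "C \<in> carrier_mat m m" "D \<in> carrier_mat m m"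
  shows "A * B * (C * D) = A * (B * C) * D"
  using assms by (simp add: assoc_mult_mat[of _ m m _ m _ m])

lemma unitary_mult:
  fixes U V :: "'a::involutive_ring mat"
  assumes U: "U \<in> carrier_mat m m" "unitary_mat U" and V: "V \<in> carrier_mat m m" "unitary_mat V"
  shows "unitary_mat (U * V)"
proof -
  have "adjoint_mat V * adjoint_mat U * (U * V) = adjoint_mat V * (adjoint_mat U * U) * V"
    using U V by (intro mult_assoc4) auto
  moreover have "U * V * (adjoint_mat V * adjoint_mat U) = U * (V * adjoint_mat V) * adjoint_mat U"
    using U V by (intro mult_assoc4) auto
  ultimately show ?thesis
    using U V by (simp add: unitary_iff[of _ m] adjoint_mult[of U m m V m] right_mult_one_mat[of _ m m])
qed

lemma unitary_adjoint:
  "U \<in> carrier_mat m m \<Longrightarrow> unitary_mat U \<Longrightarrow> unitary_mat (adjoint_mat U)"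
  by (simp add: unitary_iff[of _ m])

lemma adjoint_conjugation:
  fixes A :: "'a::involutive_ring mat"
  assumes "A \<in> carrier_mat m m" "U \<in> carrier_mat m m" "adjoint_mat A = A"
  shows "adjoint_mat (adjoint_mat U * A * U) = adjoint_mat U * A * U"
  using assms by (simp add: adjoint_mult[of _ m m _ m] assoc_mult_mat[of _ m m _ m _ m])

lemma conjugation_cancel:
  fixes A :: "'a::involutive_ring mat"
  assumes "A \<in> carrier_mat m m" "U \<in> carrier_mat m m" "unitary_mat U"
  shows "U * (adjoint_mat U * A * U) * adjoint_mat U = A"
proof -
  have "U * (adjoint_mat U * A * U) * adjoint_mat U
      = (U * adjoint_mat U) * A * (U * adjoint_mat U)"
    using assms(1,2) by (simp add: assoc_mult_mat[of _ m m _ m _ m])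
  then show ?thesis using assms by (simp add: unitary_iff[of _ m])
qed

lemma conjugated_diag_index:
  fixes W :: "'a::involutive_ring mat"
  assumes "W \<in> carrier_mat m m" "i < m" "k < m"
  shows "(W * mat_diag m d * adjoint_mat W) $$ (i, k)
    = (\<Sum>j<m. W $$ (i, j) * d j * invol (W $$ (k, j)))"
  using assms
  by (simp add: index_mult_mat_sum[of _ m m _ m] mat_diag_mult_right[of _ m m] del: index_mult_mat)


section \<open>Scalars of a ring with involution\<close>

text \<open>
  The common structure of the reals inside the quaternions and of the dual numbers inside the dual
  quaternions: \<open>\<iota>\<close> embeds the ordered scalars centrally, \<open>re\<close> is the real part. The commutation rule
  \<open>re_comm\<close> is what replaces commutativity of the entries whenever a trace is permuted cyclically.
\<close>
locale scalar_part =
  fixes \<iota> :: "'s::{linorder, ordered_comm_ring, comm_ring_1} \<Rightarrow> 'a::involutive_ring"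
    and re :: "'a \<Rightarrow> 's"
  assumes emb_central: "\<iota> s * x = x * \<iota> s"
    and re_add: "re (x + y) = re x + re y"
    and re_comm: "re (x * y) = re (y * x)"
    and re_emb_mult: "re (\<iota> s * x) = s * re x"
    and re_one: "re 1 = 1"
    and add_invol: "x + invol x = \<iota> (2 * re x)"
    and re_norm_nonneg: "0 \<le> re (x * invol x)"
begin

text \<open>
  The squared moduli of the entries. For unitary \<open>W\<close> they form a doubly stochastic matrix: its row and
  column sums are the diagonal entries of \<open>W W\<^sup>*\<close> and \<open>W\<^sup>* W\<close>.
\<close>
definition weight :: "'a mat \<Rightarrow> nat \<Rightarrow> nat \<Rightarrow> 's" where
  "weight W i j = re (W $$ (i, j) * invol (W $$ (i, j)))"

lemma re_zero [simp]: "re 0 = 0"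
  using re_add[of 0 0] by simp

lemma re_sum: "re (\<Sum>i\<in>S. f i) = (\<Sum>i\<in>S. re (f i))"
  by (induction S rule: infinite_finite_induct) (simp_all add: re_add)

lemma weight_nonneg: "0 \<le> weight W i j"
  by (simp add: weight_def re_norm_nonneg)

lemma weight_row:
  assumes "W \<in> carrier_mat m m" "unitary_mat W" "i < m"
  shows "(\<Sum>j<m. weight W i j) = 1"
proof -
  have "(\<Sum>j<m. weight W i j) = re ((W * adjoint_mat W) $$ (i, i))"
    using assms by (simp add: weight_def index_mult_mat_sum[of _ m m _ m] re_sum del: index_mult_mat)
  then show ?thesis using assms by (simp add: unitary_iff[of _ m] re_one del: index_mult_mat(1))
qed

lemma weight_col:
  assumes "W \<in> carrier_mat m m" "unitary_mat W" "j < m"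
  shows "(\<Sum>i<m. weight W i j) = 1"
proof -
  have "(\<Sum>i<m. weight W i j) = re ((adjoint_mat W * W) $$ (j, j))"
    using assms
    by (simp add: weight_def index_mult_mat_sum[of _ m m _ m] re_sum re_comm[of "invol _"] del: index_mult_mat)
  then show ?thesis using assms by (simp add: unitary_iff[of _ m] re_one del: index_mult_mat(1))
qed

lemma re_trace_comm:
  assumes "A \<in> carrier_mat m m" "B \<in> carrier_mat m m"
  shows "re (trace_mat (A * B)) = re (trace_mat (B * A))"
proof -
  have "re (trace_mat (A * B)) = (\<Sum>i<m. \<Sum>k<m. re (A $$ (i, k) * B $$ (k, i)))"
    using assms by (simp add: trace_mat_def index_mult_mat_sum[of _ m m _ m] re_sum del: index_mult_mat(1))
  also have "\<dots> = (\<Sum>k<m. \<Sum>i<m. re (B $$ (k, i) * A $$ (i, k)))"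
    by (subst sum.swap) (simp add: re_comm)
  also have "\<dots> = re (trace_mat (B * A))"
    using assms by (simp add: trace_mat_def index_mult_mat_sum[of _ m m _ m] re_sum del: index_mult_mat(1))
  finally show ?thesis .
qed

definition diagonalizes :: "nat \<Rightarrow> 'a mat \<Rightarrow> 's list \<Rightarrow> 'a mat \<Rightarrow> bool" where
  "diagonalizes m A ls U \<longleftrightarrow> length ls = m \<and> sorted_wrt (\<ge>) ls \<and> U \<in> carrier_mat m m \<and> unitary_mat U \<and>
     A = U * mat_diag m (\<lambda>i. \<iota> (ls ! i)) * adjoint_mat U"

lemma diagonalizes_antimono:
  "diagonalizes m A ls U \<Longrightarrow> i \<le> j \<Longrightarrow> j < m \<Longrightarrow> ls ! j \<le> ls ! i"
  by (cases "i = j") (auto simp: diagonalizes_def sorted_wrt_iff_nth_less)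

text \<open>
  With \<open>W = V\<^sup>* U\<close> the second diagonal is the diagonal of \<open>W D W\<^sup>*\<close>, and hence a doubly stochastic
  average of the first one. Exchanging the two diagonalisations gives the reverse inequality, and
  so the uniqueness of the eigenvalues.
\<close>
lemma partial_sums_le:
  assumes U: "diagonalizes m A ls U" and V: "diagonalizes m A ms V" and k: "k \<le> m"
  shows "(\<Sum>j<k. ms ! j) \<le> (\<Sum>j<k. ls ! j)"
proof -
  define W where "W = adjoint_mat V * U"
  define D where "D = mat_diag m (\<lambda>i. \<iota> (ls ! i))"
  define E where "E = mat_diag m (\<lambda>i. \<iota> (ms ! i))"
  have Uc: "U \<in> carrier_mat m m" "unitary_mat U" and Vc: "V \<in> carrier_mat m m" "unitary_mat V"
    using U V by (auto simp: diagonalizes_def)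
  have W: "W \<in> carrier_mat m m" "unitary_mat W"
    using Uc Vc unitary_mult[of "adjoint_mat V" m U] unitary_adjoint[of V m] by (auto simp: W_def)
  have DE: "D \<in> carrier_mat m m" "E \<in> carrier_mat m m"
    by (auto simp: D_def E_def)
  have "U * D * adjoint_mat U = V * E * adjoint_mat V"
    using U V by (simp add: diagonalizes_def D_def E_def)
  then have "adjoint_mat V * (U * D * adjoint_mat U) * V = adjoint_mat V * (V * E * adjoint_mat V) * V"
    by simp
  also have "\<dots> = E"
    using conjugation_cancel[of E m "adjoint_mat V"] DE Vc unitary_adjoint[of V m] by simp
  finally have E: "E = W * D * adjoint_mat W"
    using Uc Vc DE
    by (simp add: W_def adjoint_mult[of _ m m _ m] assoc_mult_mat[of _ m m _ m _ m])
  have ms: "ms ! j = (\<Sum>i<m. ls ! i * weight (adjoint_mat W) i j)" if j: "j < m" for j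
  proof -
    have "ms ! j = re (E $$ (j, j))"
      using j re_emb_mult[of "ms ! j" 1] by (simp add: E_def mat_diag_def re_one)
    also have "\<dots> = (\<Sum>i<m. re (W $$ (j, i) * \<iota> (ls ! i) * invol (W $$ (j, i))))"
      unfolding E D_def using W j by (simp add: conjugated_diag_index re_sum del: index_mult_mat)
    also have "\<dots> = (\<Sum>i<m. ls ! i * weight (adjoint_mat W) i j)"
      using W j by (intro sum.cong)
        (auto simp: weight_def invol_invol emb_central[symmetric] mult.assoc re_emb_mult
          re_comm[of _ "invol _"])
    finally show ?thesis .
  qed
  have "(\<Sum>j<k. ms ! j) = (\<Sum>j<k. \<Sum>i<m. ls ! i * weight (adjoint_mat W) i j)"
    using k by (intro sum.cong) (auto simp: ms)
  also have "\<dots> \<le> (\<Sum>j<k. ls ! j)"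
    by (rule doubly_stochastic_partial_sum_le[OF diagonalizes_antimono[OF U] weight_nonneg
          weight_row[OF adjoint_carrier[OF W(1)] unitary_adjoint[OF W]]
          weight_col[OF adjoint_carrier[OF W(1)] unitary_adjoint[OF W]] k])
  finally show ?thesis .
qed

lemma eigenvalue_list_unique:
  assumes U: "diagonalizes m A ls U" and V: "diagonalizes m A ms V"
  shows "ls = ms"
proof (rule nth_equalityI)
  show "length ls = length ms"
    using U V by (simp add: diagonalizes_def)
  fix i assume "i < length ls"
  then have i: "Suc i \<le> m"
    using U by (simp add: diagonalizes_def)
  have "(\<Sum>j<k. ls ! j) = (\<Sum>j<k. ms ! j)" if "k \<le> m" for k
    using partial_sums_le[OF U V that] partial_sums_le[OF V U that] by (rule antisym[rotated])
  from this[of i] this[of "Suc i"] i show "ls ! i = ms ! i"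
    by simp
qed

lemma eigvals_eq:
  assumes "diagonalizes m A ls U"
  shows "eigvals \<iota> A = ls"
proof -
  have "A \<in> carrier_mat m m"
    using assms by (auto simp: diagonalizes_def)
  then have dim: "dim_row A = m"
    by simp
  have "eigvals \<iota> A = (THE ls. \<exists>U. diagonalizes m A ls U)"
    unfolding eigvals_def diagonalizes_def dim by (intro arg_cong[where f = The] ext) blast
  also have "\<dots> = ls"
    using assms eigenvalue_list_unique by (intro the_equality) blast+
  finally show ?thesis .
qed

text \<open>
  Cyclic permutation under the real part turns the trace of \<open>A B\<close> into that of \<open>D W E W\<^sup>*\<close>, which is a
  sum over the entries of \<open>W\<close> weighted by their squared moduli.
\<close>
lemma re_trace_mult_le:
  assumes U: "diagonalizes m A ls U" and V: "diagonalizes m B ms V"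
  shows "re (trace_mat (A * B)) \<le> (\<Sum>i<m. ls ! i * ms ! i)"
proof -
  define W where "W = adjoint_mat U * V"
  define D where "D = mat_diag m (\<lambda>i. \<iota> (ls ! i))"
  define E where "E = mat_diag m (\<lambda>i. \<iota> (ms ! i))"
  have Uc: "U \<in> carrier_mat m m" "unitary_mat U" and Vc: "V \<in> carrier_mat m m" "unitary_mat V"
    and AB: "A = U * D * adjoint_mat U" "B = V * E * adjoint_mat V"
    using U V by (auto simp: diagonalizes_def D_def E_def)
  have W: "W \<in> carrier_mat m m" "unitary_mat W"
    using Uc Vc unitary_mult[of "adjoint_mat U" m V] unitary_adjoint[of U m] by (auto simp: W_def)
  have DE: "D \<in> carrier_mat m m" "E \<in> carrier_mat m m"
    by (auto simp: D_def E_def)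
  have "A * B = U * (D * adjoint_mat U * (V * E * adjoint_mat V))"
    using Uc Vc DE by (simp add: AB assoc_mult_mat[of _ m m _ m _ m])
  then have "re (trace_mat (A * B)) = re (trace_mat (D * adjoint_mat U * (V * E * adjoint_mat V) * U))"
    using re_trace_comm[of U m "D * adjoint_mat U * (V * E * adjoint_mat V)"] Uc Vc DE by auto
  also have "D * adjoint_mat U * (V * E * adjoint_mat V) * U = D * (W * E * adjoint_mat W)"
    using Uc Vc DE by (simp add: W_def adjoint_mult[of _ m m _ m] assoc_mult_mat[of _ m m _ m _ m])
  also have "re (trace_mat (D * (W * E * adjoint_mat W)))
      = (\<Sum>i<m. re (\<iota> (ls ! i) * (\<Sum>j<m. W $$ (i, j) * \<iota> (ms ! j) * invol (W $$ (i, j)))))"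
    using W DE unfolding D_def E_def
    by (simp add: trace_mat_def re_sum mat_diag_mult_left[of _ m m] conjugated_diag_index
        del: index_mult_mat(1))
  also have "\<dots> = (\<Sum>i<m. \<Sum>j<m. ls ! i * ms ! j * weight W i j)"
    by (simp add: re_emb_mult re_sum weight_def emb_central[symmetric] mult.assoc sum_distrib_left)
  also have "\<dots> \<le> (\<Sum>i<m. ls ! i * ms ! i)"
    by (rule doubly_stochastic_rearrangement[OF diagonalizes_antimono[OF U]
          diagonalizes_antimono[OF V] weight_nonneg weight_row[OF W] weight_col[OF W]])
  finally show ?thesis .
qed

lemma trace_anticommutator_le:
  assumes A: "A \<in> carrier_mat m m" "hermitian_mat A" and B: "B \<in> carrier_mat m m" "hermitian_mat B"
    and U: "diagonalizes m A ls U" and V: "diagonalizes m B ms V"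
  shows "\<exists>t. trace_mat (A * B + B * A) = \<iota> t \<and> t \<le> 2 * (\<Sum>i<m. eigvals \<iota> A ! i * eigvals \<iota> B ! i)"
proof (intro exI conjI)
  let ?r = "re (trace_mat (A * B))"
  have "adjoint_mat (A * B) = B * A"
    using A B by (simp add: adjoint_mult[of _ m m _ m] hermitianD)
  then have entry: "(B * A) $$ (i, i) = invol ((A * B) $$ (i, i))" if "i < m" for i
    using adjoint_index[of "A * B" m m i i] A B that by simp
  have "trace_mat (A * B + B * A) = trace_mat (A * B) + invol (trace_mat (A * B))"
    using A B entry by (simp add: trace_mat_def sum.distrib invol_sum del: index_mult_mat(1))
  then show "trace_mat (A * B + B * A) = \<iota> (2 * ?r)"
    by (simp only: add_invol)
  have "?r + ?r \<le> (\<Sum>i<m. ls ! i * ms ! i) + (\<Sum>i<m. ls ! i * ms ! i)"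
    using re_trace_mult_le[OF U V] by (intro add_mono)
  then show "2 * ?r \<le> 2 * (\<Sum>i<m. eigvals \<iota> A ! i * eigvals \<iota> B ! i)"
    by (simp only: eigvals_eq[OF U] eigvals_eq[OF V] mult_2)
qed

end


section \<open>Quaternion coordinates\<close>

lemmas quat_simps = quat_eq_iff zero_quat_def one_quat_def plus_quat_def uminus_quat_def
  minus_quat_def times_quat_def scaleR_quat_def invol_quat_def

lemma of_real_quat: "(of_real r :: quat) = Quat r 0 0 0"
  by (simp add: of_real_def quat_simps)

definition quat_norm2 :: "quat \<Rightarrow> real" where
  "quat_norm2 x = (quat_re x)\<^sup>2 + (quat_i x)\<^sup>2 + (quat_j x)\<^sup>2 + (quat_k x)\<^sup>2"

lemma quat_norm2_nonneg: "0 \<le> quat_norm2 x"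
  by (simp add: quat_norm2_def)

lemma quat_norm2_eq_0_iff: "quat_norm2 x = 0 \<longleftrightarrow> x = 0"
  by (simp add: quat_norm2_def quat_simps add_nonneg_eq_0_iff)

lemma quat_mult_invol: "x * invol x = of_real (quat_norm2 x)" "invol x * x = of_real (quat_norm2 x)"
  by (simp_all add: quat_norm2_def of_real_quat quat_simps power2_eq_square)

lemma quat_re_zero [simp]: "quat_re 0 = 0"
  and quat_re_add: "quat_re (x + y) = quat_re x + quat_re y"
  by (simp_all add: quat_simps)

lemma quat_re_sum: "quat_re (\<Sum>i\<in>S. f i) = (\<Sum>i\<in>S. quat_re (f i))"
  by (induction S rule: infinite_finite_induct) (simp_all add: quat_re_add)

lemma self_adjoint_quat:
  "invol x = x \<Longrightarrow> x = of_real (quat_re x)"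
  by (simp add: of_real_quat quat_simps)


section \<open>Lexicographic maximisation over the unitary quaternion matrices\<close>

text \<open>
  Strictly decreasing weights make the maximiser put the larger diagonal entries first, so that the
  eigenvalues come out sorted.
\<close>
definition weighted_diag :: "quat mat \<Rightarrow> real" where
  "weighted_diag M = (\<Sum>i<dim_row M. - real i * quat_re (M $$ (i, i)))"

definition objective :: "quat mat \<Rightarrow> quat mat \<Rightarrow> real" where
  "objective A U = weighted_diag (adjoint_mat U * A * U)"

text \<open>
  Continuity of each of the four coordinates takes the place of a topology on the quaternions.
\<close>
definition qcontinuous :: "('b::topological_space \<Rightarrow> quat) \<Rightarrow> bool" where
  "qcontinuous F \<longleftrightarrow> continuous_on UNIV (\<lambda>f. quat_re (F f)) \<and> continuous_on UNIV (\<lambda>f. quat_i (F f)) \<and>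
     continuous_on UNIV (\<lambda>f. quat_j (F f)) \<and> continuous_on UNIV (\<lambda>f. quat_k (F f))"

lemma qcontinuous_const: "qcontinuous (\<lambda>f. c)"
  by (simp add: qcontinuous_def)

lemma qcontinuous_add: "qcontinuous F \<Longrightarrow> qcontinuous G \<Longrightarrow> qcontinuous (\<lambda>f. F f + G f)"
  by (auto simp: qcontinuous_def plus_quat_def intro!: continuous_intros)

lemma qcontinuous_mult: "qcontinuous F \<Longrightarrow> qcontinuous G \<Longrightarrow> qcontinuous (\<lambda>f. F f * G f)"
  by (auto simp: qcontinuous_def times_quat_def intro!: continuous_intros)

lemma qcontinuous_invol: "qcontinuous F \<Longrightarrow> qcontinuous (\<lambda>f. invol (F f))"
  by (auto simp: qcontinuous_def invol_quat_def intro!: continuous_intros)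

lemma qcontinuous_sum:
  "(\<And>i. i \<in> S \<Longrightarrow> qcontinuous (F i)) \<Longrightarrow> qcontinuous (\<lambda>f. \<Sum>i\<in>S. F i f)"
  by (induction S rule: infinite_finite_induct) (auto intro: qcontinuous_add qcontinuous_const)

lemma closed_qcontinuous_eq:
  "qcontinuous F \<Longrightarrow> closed {f. F f = c}"
  unfolding qcontinuous_def quat_eq_iff
  by (intro closed_Collect_conj closed_Collect_eq) auto

text \<open>
  Matrices are parametrised by real functions on triples (row, column, coordinate), so that compactness
  of the unitary group follows from compactness of a product of intervals.
\<close>
definition quat_mat_of :: "nat \<Rightarrow> (nat \<times> nat \<times> nat \<Rightarrow> real) \<Rightarrow> quat mat" where
  "quat_mat_of m f = mat m m (\<lambda>(i, j). Quat (f (i, j, 0)) (f (i, j, 1)) (f (i, j, 2)) (f (i, j, 3)))"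

lemma quat_mat_of_carrier [simp]: "quat_mat_of m f \<in> carrier_mat m m"
  by (simp add: quat_mat_of_def)

lemma qcontinuous_quat_mat_of: "i < m \<Longrightarrow> j < m \<Longrightarrow> qcontinuous (\<lambda>f. quat_mat_of m f $$ (i, j))"
  by (simp add: quat_mat_of_def qcontinuous_def)

definition unitary_cube :: "nat \<Rightarrow> (nat \<times> nat \<times> nat \<Rightarrow> real) set" where
  "unitary_cube m = {f. (\<forall>x. f x \<in> {-1..1}) \<and> unitary_mat (quat_mat_of m f)}"

lemma compact_unitary_cube: "compact (unitary_cube m)"
proof -
  have "compact (PiE UNIV (\<lambda>x. {-1..1}) :: (nat \<times> nat \<times> nat \<Rightarrow> real) set)"
    using compactin_PiE[of "\<lambda>_. euclidean :: real topology" UNIV "\<lambda>_::nat \<times> nat \<times> nat. {-1..1}"]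
    by (simp add: euclidean_product_topology)
  moreover have "closed {f. unitary_mat (quat_mat_of m f)}"
  proof -
    let ?U = "quat_mat_of m"
    have "{f. unitary_mat (?U f)} = (\<Inter>i\<in>{..<m}. \<Inter>j\<in>{..<m}.
        {f. (\<Sum>k<m. invol (?U f $$ (k, i)) * ?U f $$ (k, j)) = 1\<^sub>m m $$ (i, j)} \<inter>
        {f. (\<Sum>k<m. ?U f $$ (i, k) * invol (?U f $$ (j, k))) = 1\<^sub>m m $$ (i, j)})"
      by (auto simp: unitary_iff_entries[OF quat_mat_of_carrier])
    also have "closed \<dots>"
      by (intro closed_INT ballI closed_Int closed_qcontinuous_eq
          qcontinuous_sum qcontinuous_mult qcontinuous_invol qcontinuous_quat_mat_of) auto
    finally show ?thesis .
  qed
  moreover have "unitary_cube m = PiE UNIV (\<lambda>x. {-1..1}) \<inter> {f. unitary_mat (quat_mat_of m f)}"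
    by (auto simp: unitary_cube_def PiE_def)
  ultimately show ?thesis
    by (simp add: compact_Int_closed)
qed

lemma objective_carrier:
  assumes "A \<in> carrier_mat m m" "U \<in> carrier_mat m m"
  shows "objective A U
    = (\<Sum>i<m. - real i * quat_re (\<Sum>l<m. (\<Sum>k<m. invol (U $$ (k, i)) * A $$ (k, l)) * U $$ (l, i)))"
  using assms
  by (simp add: objective_def weighted_diag_def index_mult_mat_sum[of _ m m _ m] del: index_mult_mat(1))

lemma continuous_objective:
  assumes "A \<in> carrier_mat m m"
  shows "continuous_on UNIV (\<lambda>f. objective A (quat_mat_of m f))"
proof -
  have "qcontinuous (\<lambda>f. \<Sum>l<m. (\<Sum>k<m. invol (quat_mat_of m f $$ (k, i)) * A $$ (k, l)) * quat_mat_of m f $$ (l, i))"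
    if "i < m" for i
    using that by (intro qcontinuous_sum qcontinuous_mult qcontinuous_invol qcontinuous_quat_mat_of
        qcontinuous_const) auto
  then show ?thesis
    unfolding objective_carrier[OF assms quat_mat_of_carrier] qcontinuous_def
    by (intro continuous_on_sum continuous_on_mult_left) auto
qed

lemma unitary_quat_norm2_le:
  assumes U: "U \<in> carrier_mat m m" "unitary_mat U" and ij: "i < m" "j < m"
  shows "quat_norm2 (U $$ (i, j)) \<le> 1"
proof -
  have "quat_norm2 (U $$ (i, j)) \<le> (\<Sum>k<m. quat_norm2 (U $$ (k, j)))"
    using ij by (intro member_le_sum) (auto simp: quat_norm2_nonneg)
  also have "\<dots> = quat_re ((adjoint_mat U * U) $$ (j, j))"
    using U ij by (simp add: index_mult_mat_sum[of _ m m _ m] quat_mult_invol quat_re_sum of_real_quat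
        del: index_mult_mat)
  also have "\<dots> = 1"
    using U ij by (simp add: unitary_iff[of _ m] one_quat_def)
  finally show ?thesis .
qed

lemma unitary_in_cube:
  assumes U: "U \<in> carrier_mat m m" "unitary_mat U"
  obtains f where "f \<in> unitary_cube m" "quat_mat_of m f = U"
proof -
  define f where "f = (\<lambda>(i, j, k). if i < m \<and> j < m \<and> k < (4::nat)
    then [quat_re (U $$ (i, j)), quat_i (U $$ (i, j)), quat_j (U $$ (i, j)), quat_k (U $$ (i, j))] ! k
    else 0)"
  have eq: "quat_mat_of m f = U"
    using U by (intro eq_matI) (auto simp: quat_mat_of_def f_def quat_eq_iff)
  have coord: "\<bar>quat_re x\<bar> \<le> 1 \<and> \<bar>quat_i x\<bar> \<le> 1 \<and> \<bar>quat_j x\<bar> \<le> 1 \<and> \<bar>quat_k x\<bar> \<le> 1" if "quat_norm2 x \<le> 1" for x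
    using that zero_le_power2[of "quat_re x"] zero_le_power2[of "quat_i x"]
      zero_le_power2[of "quat_j x"] zero_le_power2[of "quat_k x"]
    unfolding quat_norm2_def abs_square_le_1[symmetric] by linarith
  have "\<bar>f (i, j, k)\<bar> \<le> 1" for i j k
  proof (cases "i < m \<and> j < m \<and> k < 4")
    case True
    then have "k \<in> {0, 1, 2, 3}" by auto
    with True coord[OF unitary_quat_norm2_le[OF U, of i j]] show ?thesis
      by (auto simp: f_def)
  qed (auto simp: f_def)
  then have "f \<in> unitary_cube m"
    using U by (auto simp: unitary_cube_def eq abs_le_iff minus_le_iff)
  with eq that show thesis by blast
qed

text \<open>
  The set of maximisers of the first objective is again compact, hence the second objective attains a
  maximum on it.
\<close>
lemma unitary_lex_maximizer:
  assumes A: "A \<in> carrier_mat m m" and B: "B \<in> carrier_mat m m"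
  obtains U where "U \<in> carrier_mat m m" "unitary_mat U"
    "\<And>V. V \<in> carrier_mat m m \<Longrightarrow> unitary_mat V \<Longrightarrow> objective A V \<le> objective A U"
    "\<And>V. V \<in> carrier_mat m m \<Longrightarrow> unitary_mat V \<Longrightarrow> objective A V = objective A U \<Longrightarrow> objective B V \<le> objective B U"
proof -
  let ?f = "\<lambda>C f. objective C (quat_mat_of m f)"
  have "unitary_mat (1\<^sub>m m :: quat mat)"
    by (simp add: unitary_iff[of _ m])
  then have ne: "unitary_cube m \<noteq> {}"
    using unitary_in_cube[of "1\<^sub>m m" m] by auto
  obtain f where f: "f \<in> unitary_cube m" "\<And>g. g \<in> unitary_cube m \<Longrightarrow> ?f A g \<le> ?f A f"
    using continuous_attains_sup[OF compact_unitary_cube ne, of "?f A"]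
      continuous_on_subset[OF continuous_objective[OF A]] by blast
  define K where "K = unitary_cube m \<inter> {g. ?f A g = ?f A f}"
  have "closed {g. ?f A g = ?f A f}"
    using continuous_objective[OF A] by (intro closed_Collect_eq) auto
  then have "compact K"
    unfolding K_def by (intro compact_Int_closed compact_unitary_cube)
  moreover have "K \<noteq> {}"
    using f by (auto simp: K_def)
  ultimately obtain h where h: "h \<in> K" "\<And>g. g \<in> K \<Longrightarrow> ?f B g \<le> ?f B h"
    using continuous_attains_sup[of K "?f B"] continuous_on_subset[OF continuous_objective[OF B]] by blast
  show thesis
  proof (rule that[of "quat_mat_of m h"])
    show "unitary_mat (quat_mat_of m h)"
      using h by (simp add: K_def unitary_cube_def)
  next
    fix V :: "quat mat" assume V: "V \<in> carrier_mat m m" "unitary_mat V"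
    obtain g where g: "g \<in> unitary_cube m" "quat_mat_of m g = V"
      using unitary_in_cube[OF V] .
    show "objective A V \<le> objective A (quat_mat_of m h)"
      using f(2)[OF g(1)] g h by (simp add: K_def)
    show "objective B V \<le> objective B (quat_mat_of m h)"
      if "objective A V = objective A (quat_mat_of m h)"
      using h(2)[of g] h(1) that g by (simp add: K_def)
  qed simp
qed

section \<open>Rotations in a coordinate plane\<close>

text \<open>
  The identity outside the coordinates \<open>p\<close> and \<open>q\<close>, and inside them the matrix with columns
  \<open>(a, b)\<close> and \<open>(- invol b, a)\<close>. The first entry \<open>a\<close> is real, which makes the two columns orthogonal
  although the quaternions do not commute.
\<close>
definition plane_rotation :: "nat \<Rightarrow> nat \<Rightarrow> nat \<Rightarrow> real \<Rightarrow> quat \<Rightarrow> quat mat" where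
  "plane_rotation m p q a b = mat m m (\<lambda>(i, j).
     if j = p then (if i = p then of_real a else if i = q then b else 0)
     else if j = q then (if i = p then - invol b else if i = q then of_real a else 0)
     else if i = j then 1 else 0)"

lemma plane_rotation_carrier [simp]: "plane_rotation m p q a b \<in> carrier_mat m m"
  by (simp add: plane_rotation_def)

context
  fixes m p q :: nat
  assumes pq: "p < q" "q < m"
begin

lemma sum_pair:
  assumes "\<And>k. k < m \<Longrightarrow> k \<noteq> p \<Longrightarrow> k \<noteq> q \<Longrightarrow> f k = (0::'c::comm_monoid_add)"
  shows "(\<Sum>k<m. f k) = f p + f q"
proof -
  have "(\<Sum>k<m. f k) = (\<Sum>k\<in>{p, q}. f k)"
    using pq assms by (intro sum.mono_neutral_right) auto
  then show ?thesis using pq by simp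
qed

lemma sum_mult_plane_rotation:
  assumes "j < m"
  shows "(\<Sum>k<m. X k * plane_rotation m p q a b $$ (k, j))
    = (if j = p then X p * of_real a + X q * b
       else if j = q then X p * (- invol b) + X q * of_real a else X j)"
proof (cases "j = p \<or> j = q")
  case True
  then show ?thesis
    using pq by (subst sum_pair) (auto simp: plane_rotation_def)
next
  case False
  then have "(\<Sum>k<m. X k * plane_rotation m p q a b $$ (k, j)) = (\<Sum>k<m. if k = j then X j else 0)"
    using assms by (intro sum.cong) (auto simp: plane_rotation_def)
  with False assms show ?thesis by simp
qed

lemma sum_invol_plane_rotation_mult:
  assumes "j < m"
  shows "(\<Sum>k<m. invol (plane_rotation m p q a b $$ (k, j)) * X k)
    = (if j = p then of_real a * X p + invol b * X q
       else if j = q then - b * X p + of_real a * X q else X j)"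
proof -
  have "(\<Sum>k<m. invol (plane_rotation m p q a b $$ (k, j)) * X k)
      = invol (\<Sum>k<m. invol (X k) * plane_rotation m p q a b $$ (k, j))"
    by (simp add: invol_sum invol_mult invol_invol)
  moreover have "invol (of_real a :: quat) = of_real a"
    by (simp add: of_real_quat invol_quat_def)
  ultimately show ?thesis
    using assms by (simp add: sum_mult_plane_rotation invol_add invol_mult invol_invol invol_minus invol_diff)
qed

lemma plane_rotation_isometry:
  assumes "a\<^sup>2 + quat_norm2 b = 1"
  shows "adjoint_mat (plane_rotation m p q a b) * plane_rotation m p q a b = 1\<^sub>m m"
proof (rule eq_matI)
  fix i j assume "i < dim_row (1\<^sub>m m :: quat mat)" "j < dim_col (1\<^sub>m m :: quat mat)"
  then have ij: "i < m" "j < m" by auto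
  let ?R = "plane_rotation m p q a b"
  have n: "quat_norm2 b = 1 - a\<^sup>2" using assms by simp
  have comm: "of_real a * x = x * of_real a" for x :: quat
    by (simp add: of_real_quat quat_simps)
  have "(adjoint_mat ?R * ?R) $$ (i, j) = (\<Sum>k<m. invol (?R $$ (k, i)) * ?R $$ (k, j))"
    using ij by (simp add: index_mult_mat_sum[of _ m m _ m] adjoint_index[of _ m m] del: index_mult_mat)
  also have "\<dots> = 1\<^sub>m m $$ (i, j)"
    using ij pq unfolding sum_invol_plane_rotation_mult[OF ij(1)]
    by (auto simp: plane_rotation_def quat_mult_invol comm n of_real_mult[symmetric] power2_eq_square
        simp del: of_real_mult)
  finally show "(adjoint_mat ?R * ?R) $$ (i, j) = 1\<^sub>m m $$ (i, j)" .
qed (auto simp: adjoint_mat_def plane_rotation_def)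

text \<open>
  The adjoint is again a rotation, so the isometry property for \<open>- b\<close> yields the second half of
  unitarity.
\<close>
lemma adjoint_plane_rotation:
  "adjoint_mat (plane_rotation m p q a b) = plane_rotation m p q a (- b)"
  using pq by (intro eq_matI)
    (auto simp: adjoint_mat_def plane_rotation_def invol_minus invol_invol of_real_quat quat_simps)

lemma plane_rotation_unitary:
  assumes "a\<^sup>2 + quat_norm2 b = 1"
  shows "unitary_mat (plane_rotation m p q a b)"
proof -
  have "a\<^sup>2 + quat_norm2 (- b) = 1"
    using assms by (simp add: quat_norm2_def uminus_quat_def)
  from plane_rotation_isometry[OF this] plane_rotation_isometry[OF assms] show ?thesis
    by (simp add: unitary_iff[of _ m] adjoint_plane_rotation)
qed

text \<open>
  Only the diagonal entries \<open>p\<close> and \<open>q\<close> change, and they change by opposite amounts because their sum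
  is preserved. For \<open>M\<close> diagonal with equal entries in these two places the change is 0.
\<close>
lemma weighted_diag_plane_rotation:
  assumes M: "M \<in> carrier_mat m m" "adjoint_mat M = M" and ab: "a\<^sup>2 + quat_norm2 b = 1"
  defines "R \<equiv> plane_rotation m p q a b"
  shows "weighted_diag (adjoint_mat R * M * R) - weighted_diag M
    = (real q - real p) * (quat_norm2 b * (quat_re (M $$ (q, q)) - quat_re (M $$ (p, p)))
        + 2 * a * quat_re (invol b * M $$ (q, p)))"
proof -
  have R: "R \<in> carrier_mat m m" by (simp add: R_def)
  define N where "N = adjoint_mat R * M * R"
  have Ndim: "dim_row N = m" using R M by (simp add: N_def)
  have N: "N $$ (i, i) = (\<Sum>k<m. invol (R $$ (k, i)) * (\<Sum>l<m. M $$ (k, l) * R $$ (l, i)))" if "i < m" for i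
    using that R M
    by (simp add: N_def assoc_mult_mat[of _ m m _ m _ m] index_mult_mat_sum[of _ m m _ m] del: index_mult_mat)
  have Mpq: "M $$ (p, q) = invol (M $$ (q, p))"
    using adjoint_index[OF M(1), of p q] M(2) pq by simp
  define s where "s = quat_re (M $$ (p, p))"
  define t where "t = quat_re (M $$ (q, q))"
  define z where "z = M $$ (q, p)"
  have Mpp: "M $$ (p, p) = of_real s" and Mqq: "M $$ (q, q) = of_real t"
    using adjoint_index[OF M(1), of p p] adjoint_index[OF M(1), of q q] M(2) pq
    by (auto simp: s_def t_def intro: self_adjoint_quat)
  have other: "N $$ (i, i) = M $$ (i, i)" if "i < m" "i \<noteq> p" "i \<noteq> q" for i
    using that unfolding N[OF that(1)] R_def
    by (simp add: sum_invol_plane_rotation_mult sum_mult_plane_rotation)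
  have expand: "quat_re (of_real a * (of_real s * of_real a + invol z * b) + invol b * (z * of_real a + of_real t * b))
        = a\<^sup>2 * s + quat_norm2 b * t + 2 * a * quat_re (invol b * z)" (is "quat_re ?x = _")
    "quat_re (- b * (of_real s * (- invol b) + invol z * of_real a) + of_real a * (z * (- invol b) + of_real t * of_real a))
        = quat_norm2 b * s + a\<^sup>2 * t - 2 * a * quat_re (invol b * z)" (is "quat_re ?y = _")
    by (simp_all add: of_real_quat quat_simps quat_norm2_def power2_eq_square algebra_simps)
  have a2: "a\<^sup>2 = 1 - quat_norm2 b" using ab by simp
  have "N $$ (p, p) = ?x" "N $$ (q, q) = ?y"
    using pq unfolding N[OF less_trans[OF pq]] N[OF pq(2)] R_def
    by (simp_all add: sum_invol_plane_rotation_mult sum_mult_plane_rotation Mpp Mqq Mpq z_def)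
  then have Np: "quat_re (N $$ (p, p)) - s = quat_norm2 b * (t - s) + 2 * a * quat_re (invol b * z)"
    and Nq: "quat_re (N $$ (q, q)) - t = - (quat_norm2 b * (t - s) + 2 * a * quat_re (invol b * z))"
    by (simp_all only: expand a2) (simp_all add: algebra_simps)
  have "weighted_diag N - weighted_diag M = (\<Sum>i<m. - real i * (quat_re (N $$ (i, i)) - quat_re (M $$ (i, i))))"
    using M by (simp add: weighted_diag_def Ndim sum_subtractf[symmetric] algebra_simps)
  also have "\<dots> = - real p * (quat_re (N $$ (p, p)) - s) + - real q * (quat_re (N $$ (q, q)) - t)"
    unfolding s_def t_def by (rule sum_pair) (simp add: other)
  also have "\<dots> = (real q - real p) * (quat_norm2 b * (t - s) + 2 * a * quat_re (invol b * z))"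
    unfolding Np Nq by (simp add: algebra_simps)
  finally show ?thesis unfolding N_def s_def t_def z_def .
qed

text \<open>
  The rotation with \<open>a = 0\<close> and \<open>b = 1\<close> exchanges the two diagonal entries and shows that they are in
  nonincreasing order. If the off-diagonal entry \<open>z\<close> were nonzero, a rotation with \<open>b\<close> proportional to
  \<open>z\<close> would gain to first order in \<open>b\<close> but lose only to second order.
\<close>
lemma rotation_maximal_imp_diagonal:
  assumes M: "M \<in> carrier_mat m m" "adjoint_mat M = M"
    and max: "\<And>a b. a\<^sup>2 + quat_norm2 b = 1 \<Longrightarrow>
      weighted_diag (adjoint_mat (plane_rotation m p q a b) * M * plane_rotation m p q a b) \<le> weighted_diag M"
  shows "quat_re (M $$ (q, q)) \<le> quat_re (M $$ (p, p))" "M $$ (q, p) = 0"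
proof -
  define d where "d = quat_re (M $$ (p, p)) - quat_re (M $$ (q, q))"
  define z where "z = M $$ (q, p)"
  have key: "- quat_norm2 b * d + 2 * a * quat_re (invol b * z) \<le> 0" if "a\<^sup>2 + quat_norm2 b = 1" for a b
  proof -
    have "(real q - real p) * (- quat_norm2 b * d + 2 * a * quat_re (invol b * z)) \<le> 0"
      using max[OF that] weighted_diag_plane_rotation[OF M that] by (simp add: d_def z_def algebra_simps)
    then show ?thesis using pq by (simp add: mult_le_0_iff)
  qed
  have d: "0 \<le> d"
    using key[of 0 1] by (simp add: quat_norm2_def one_quat_def)
  then show "quat_re (M $$ (q, q)) \<le> quat_re (M $$ (p, p))"
    by (simp add: d_def)
  show "M $$ (q, p) = 0"
  proof (rule ccontr)
    assume "M $$ (q, p) \<noteq> 0"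
    then have s: "quat_norm2 z > 0"
      using quat_norm2_nonneg[of z] quat_norm2_eq_0_iff[of z] by (simp add: z_def less_le)
    \<comment> \<open>The pair \<open>(d + 1, z)\<close> has positive gain, by the bound \<open>2 (d + 1) > d\<close>; the gain is homogeneous
      of degree 2, so the pair may be normalised by \<open>r\<close>.\<close>
    define a where "a = d + 1"
    define n where "n = a\<^sup>2 + quat_norm2 z"
    have n: "n > 0" using s by (simp add: n_def add_nonneg_pos)
    define r where "r = 1 / sqrt n"
    have r: "r\<^sup>2 * n = 1" "r \<noteq> 0"
      using n by (simp_all add: r_def power_divide)
    have scale: "quat_norm2 (r *\<^sub>R z) = r\<^sup>2 * quat_norm2 z"
      "quat_re (invol (r *\<^sub>R z) * z) = r * quat_norm2 z"
      by (simp_all add: quat_norm2_def quat_simps power2_eq_square algebra_simps)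
    have "(r * a)\<^sup>2 + quat_norm2 (r *\<^sub>R z) = 1"
      using r by (simp add: scale n_def power_mult_distrib algebra_simps)
    from key[OF this] have "r\<^sup>2 * quat_norm2 z * (2 * a - d) \<le> 0"
      by (simp add: scale power2_eq_square algebra_simps)
    moreover have "r\<^sup>2 * quat_norm2 z * (2 * a - d) > 0"
      using r s d by (simp add: a_def)
    ultimately show False by simp
  qed
qed

end

text \<open>
  At a lexicographic maximiser, \<open>A\<close> becomes diagonal and sorted, and \<open>B\<close> becomes diagonal and sorted between indices
  with the same eigenvalue of \<open>A\<close>: rotations in such a plane stay among the maximisers for \<open>A\<close>.
\<close>
lemma simultaneous_lex_diagonalization:
  assumes A: "A \<in> carrier_mat m m" "adjoint_mat A = A" and B: "B \<in> carrier_mat m m" "adjoint_mat B = B"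
  obtains U where "U \<in> carrier_mat m m" "unitary_mat U"
    "\<And>p q. p < q \<Longrightarrow> q < m \<Longrightarrow> quat_re ((adjoint_mat U * A * U) $$ (q, q)) \<le> quat_re ((adjoint_mat U * A * U) $$ (p, p))"
    "\<And>p q. p < q \<Longrightarrow> q < m \<Longrightarrow> (adjoint_mat U * A * U) $$ (q, p) = 0"
    "\<And>p q. p < q \<Longrightarrow> q < m \<Longrightarrow>
      quat_re ((adjoint_mat U * A * U) $$ (q, q)) = quat_re ((adjoint_mat U * A * U) $$ (p, p)) \<Longrightarrow>
      quat_re ((adjoint_mat U * B * U) $$ (q, q)) \<le> quat_re ((adjoint_mat U * B * U) $$ (p, p)) \<and>
      (adjoint_mat U * B * U) $$ (q, p) = 0"
proof -
  obtain U where U: "U \<in> carrier_mat m m" "unitary_mat U"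
    and maxA: "\<And>V. V \<in> carrier_mat m m \<Longrightarrow> unitary_mat V \<Longrightarrow> objective A V \<le> objective A U"
    and maxB: "\<And>V. V \<in> carrier_mat m m \<Longrightarrow> unitary_mat V \<Longrightarrow> objective A V = objective A U \<Longrightarrow> objective B V \<le> objective B U"
    by (rule unitary_lex_maximizer[OF A(1) B(1)]) (rule that; blast)
  define M where "M = adjoint_mat U * A * U"
  define N where "N = adjoint_mat U * B * U"
  have M: "M \<in> carrier_mat m m" "adjoint_mat M = M" and N: "N \<in> carrier_mat m m" "adjoint_mat N = N"
    using adjoint_conjugation[OF A(1) U(1) A(2)] adjoint_conjugation[OF B(1) U(1) B(2)] A B U
    by (simp_all add: M_def N_def)
  have objA: "objective A (U * R) = weighted_diag (adjoint_mat R * M * R)"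
    and objB: "objective B (U * R) = weighted_diag (adjoint_mat R * N * R)"
    if "R \<in> carrier_mat m m" for R
    using that U A B
    by (simp_all add: objective_def M_def N_def adjoint_mult[of _ m m _ m] assoc_mult_mat[of _ m m _ m _ m])
  have objA0: "objective A U = weighted_diag M" and objB0: "objective B U = weighted_diag N"
    by (simp_all add: objective_def M_def N_def)
  have Mdiag: "quat_re (M $$ (q, q)) \<le> quat_re (M $$ (p, p))" "M $$ (q, p) = 0" if pq: "p < q" "q < m" for p q
  proof -
    have "weighted_diag (adjoint_mat (plane_rotation m p q a b) * M * plane_rotation m p q a b) \<le> weighted_diag M"
      if "a\<^sup>2 + quat_norm2 b = 1" for a b
      using maxA[of "U * plane_rotation m p q a b"] unitary_mult[OF U _ plane_rotation_unitary[OF pq that]] U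
      by (simp add: objA objA0)
    from rotation_maximal_imp_diagonal[OF pq M this]
    show "quat_re (M $$ (q, q)) \<le> quat_re (M $$ (p, p))" "M $$ (q, p) = 0" by auto
  qed
  have Ndiag: "quat_re (N $$ (q, q)) \<le> quat_re (N $$ (p, p))" "N $$ (q, p) = 0"
    if pq: "p < q" "q < m" and eq: "quat_re (M $$ (q, q)) = quat_re (M $$ (p, p))" for p q
  proof -
    have "weighted_diag (adjoint_mat (plane_rotation m p q a b) * N * plane_rotation m p q a b) \<le> weighted_diag N"
      if ab: "a\<^sup>2 + quat_norm2 b = 1" for a b
    proof -
      have "objective A (U * plane_rotation m p q a b) = objective A U"
        using weighted_diag_plane_rotation[OF pq M ab] Mdiag[OF pq] eq
        by (simp add: objA objA0)
      then show ?thesis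
        using maxB[of "U * plane_rotation m p q a b"] unitary_mult[OF U _ plane_rotation_unitary[OF pq ab]] U
        by (simp add: objB objB0)
    qed
    from rotation_maximal_imp_diagonal[OF pq N this]
    show "quat_re (N $$ (q, q)) \<le> quat_re (N $$ (p, p))" "N $$ (q, p) = 0" by auto
  qed
  show thesis
    by (rule that[OF U]) (use Mdiag Ndiag in \<open>auto simp: M_def N_def\<close>)
qed


section \<open>Matrices of dual quaternions\<close>

instance dual :: (linordered_idom) ordered_comm_ring
proof
  fix a b c :: "'a dual"
  show "c + a \<le> c + b" if "a \<le> b"
    using that by (auto simp: less_eq_dual_def less_dual_def plus_dual_def dual_eq_iff)
  show "c * a \<le> c * b" if "a \<le> b" "0 \<le> c"
    using that
    by (auto simp: less_eq_dual_def less_dual_def times_dual_def zero_dual_def dual_eq_iff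
        mult_strict_left_mono mult_left_mono)
qed

definition quat_dual_re :: "quat dual \<Rightarrow> real dual" where
  "quat_dual_re x = Dual (quat_re (std_part x)) (quat_re (inf_part x))"

lemmas dual_simps = dual_eq_iff zero_dual_def one_dual_def plus_dual_def uminus_dual_def
  minus_dual_def times_dual_def invol_dual_def

interpretation quat: scalar_part "of_real :: real \<Rightarrow> quat" quat_re
proof
  fix x :: quat
  show "0 \<le> quat_re (x * invol x)"
    by (simp add: quat_mult_invol of_real_quat quat_norm2_nonneg)
qed (simp_all add: of_real_quat quat_simps algebra_simps)

text \<open>
  The squared modulus \<open>x * invol x\<close> of a dual quaternion is nonnegative in the order of the dual numbers: its
  standard part is positive unless \<open>std_part x = 0\<close>, and then its infinitesimal part vanishes as well.
\<close>
interpretation dual_quat: scalar_part quat_of_dual quat_dual_re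
proof
  fix x :: "quat dual"
  show "0 \<le> quat_dual_re (x * invol x)"
  proof (cases "std_part x = 0")
    case True
    then show ?thesis
      by (simp add: quat_dual_re_def less_eq_dual_def dual_simps)
  next
    case False
    then have "0 < quat_norm2 (std_part x)"
      using quat_norm2_nonneg[of "std_part x"] quat_norm2_eq_0_iff[of "std_part x"] by linarith
    then show ?thesis
      by (simp add: quat_dual_re_def less_eq_dual_def less_dual_def dual_simps quat_mult_invol of_real_quat)
  qed
next
  fix x :: "quat dual"
  have "(2 :: real dual) = Dual 2 0"
    unfolding one_add_one[symmetric] by (simp add: dual_simps)
  then show "x + invol x = quat_of_dual (2 * quat_dual_re x)"
    by (simp add: quat_of_dual_def quat_dual_re_def dual_simps of_real_quat quat_simps)
qed (simp_all add: quat_of_dual_def quat_dual_re_def dual_simps of_real_quat quat_simps algebra_simps)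

definition dual_mat :: "'a mat \<Rightarrow> 'a mat \<Rightarrow> 'a dual mat" where
  "dual_mat X Y = mat (dim_row X) (dim_col X) (\<lambda>(i, j). Dual (X $$ (i, j)) (Y $$ (i, j)))"

lemma dual_mat_carrier [simp]: "X \<in> carrier_mat n m \<Longrightarrow> dual_mat X Y \<in> carrier_mat n m"
  by (auto simp: dual_mat_def)

lemma dual_mat_index [simp]:
  "X \<in> carrier_mat n m \<Longrightarrow> i < n \<Longrightarrow> j < m \<Longrightarrow> dual_mat X Y $$ (i, j) = Dual (X $$ (i, j)) (Y $$ (i, j))"
  by (auto simp: dual_mat_def)

lemma std_part_sum: "std_part (\<Sum>i\<in>S. f i) = (\<Sum>i\<in>S. std_part (f i :: 'a::ring_1 dual))"
  and inf_part_sum: "inf_part (\<Sum>i\<in>S. f i) = (\<Sum>i\<in>S. inf_part (f i :: 'a::ring_1 dual))"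
  by (induction S rule: infinite_finite_induct) (simp_all add: dual_simps)

lemma dual_mat_mult:
  fixes X Y X' Y' :: "'a::ring_1 mat"
  assumes "X \<in> carrier_mat m m" "Y \<in> carrier_mat m m" "X' \<in> carrier_mat m m" "Y' \<in> carrier_mat m m"
  shows "dual_mat X Y * dual_mat X' Y' = dual_mat (X * X') (X * Y' + Y * X')"
proof (rule eq_matI)
  fix i j assume "i < dim_row (dual_mat (X * X') (X * Y' + Y * X'))"
    "j < dim_col (dual_mat (X * X') (X * Y' + Y * X'))"
  then have ij: "i < m" "j < m"
    using assms by (auto simp: dual_mat_def)
  then show "(dual_mat X Y * dual_mat X' Y') $$ (i, j) = dual_mat (X * X') (X * Y' + Y * X') $$ (i, j)"
    using assms
    by (simp add: dual_mat_index[of _ m m] index_mult_mat_sum[of _ m m _ m] dual_eq_iff std_part_sum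
        inf_part_sum times_dual_def sum.distrib del: index_mult_mat(1))
qed (use assms in \<open>auto simp: dual_mat_def\<close>)

lemma adjoint_dual_mat:
  assumes "X \<in> carrier_mat m m" "Y \<in> carrier_mat m m"
  shows "adjoint_mat (dual_mat X Y) = dual_mat (adjoint_mat X) (adjoint_mat Y)"
  using assms by (intro eq_matI) (auto simp: dual_mat_def adjoint_mat_def invol_dual_def)

lemma dual_mat_one: "dual_mat (1\<^sub>m m) (0\<^sub>m m m) = 1\<^sub>m m"
  by (intro eq_matI) (auto simp: dual_mat_def dual_simps)

definition std_mat :: "'a dual mat \<Rightarrow> 'a mat" where
  "std_mat A = map_mat std_part A"

definition inf_mat :: "'a dual mat \<Rightarrow> 'a mat" where
  "inf_mat A = map_mat inf_part A"

lemma std_mat_carrier [simp]: "A \<in> carrier_mat n m \<Longrightarrow> std_mat A \<in> carrier_mat n m"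
  and inf_mat_carrier [simp]: "A \<in> carrier_mat n m \<Longrightarrow> inf_mat A \<in> carrier_mat n m"
  by (simp_all add: std_mat_def inf_mat_def)

lemma dual_mat_std_inf: "dual_mat (std_mat A) (inf_mat A) = A"
  by (intro eq_matI) (auto simp: dual_mat_def std_mat_def inf_mat_def)

lemma hermitian_parts:
  assumes "hermitian_mat A"
  shows "adjoint_mat (std_mat A) = std_mat A" "adjoint_mat (inf_mat A) = inf_mat A"
proof -
  have sq: "dim_row A = dim_col A"
    using assms by (simp add: hermitian_mat_def)
  have entry: "invol (A $$ (j, i)) = A $$ (i, j)" if "i < dim_row A" "j < dim_row A" for i j
    using arg_cong[OF hermitianD[OF assms], of "\<lambda>X. X $$ (i, j)"] that sq
    by (simp add: adjoint_mat_def)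
  have "invol (std_part (A $$ (j, i))) = std_part (A $$ (i, j)) \<and>
      invol (inf_part (A $$ (j, i))) = inf_part (A $$ (i, j))" if "i < dim_row A" "j < dim_row A" for i j
    using arg_cong[OF entry[OF that], of std_part] arg_cong[OF entry[OF that], of inf_part]
    by (simp add: invol_dual_def)
  then show "adjoint_mat (std_mat A) = std_mat A" "adjoint_mat (inf_mat A) = inf_mat A"
    using sq by (auto simp: std_mat_def inf_mat_def adjoint_mat_def intro!: eq_matI)
qed


section \<open>Spectral decomposition\<close>

text \<open>
  Let \<open>M = U\<^sup>* A\<^sub>s\<^sub>t U\<close> and \<open>N = U\<^sup>* A\<^sub>i\<^sub>n U\<close> for the \<open>U\<close> of the preceding lemma, so that \<open>M\<close> is
  diagonal with entries \<open>d\<^sub>i\<close>. Conjugating \<open>M + N \<epsilon>\<close> by \<open>I + P \<epsilon>\<close> with \<open>P\<close> skew-Hermitian adds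
  \<open>M P - P M\<close> to \<open>N\<close>, whose entry at \<open>(i, j)\<close> is \<open>(d\<^sub>i - d\<^sub>j) P\<^sub>i\<^sub>j\<close>. Hence \<open>P\<close> can be chosen to cancel
  every entry of \<open>N\<close> with \<open>d\<^sub>i \<noteq> d\<^sub>j\<close>, and the entries off the diagonal with \<open>d\<^sub>i = d\<^sub>j\<close> are 0 already.
\<close>
lemma dual_quat_spectral_decomposition:
  assumes A: "A \<in> carrier_mat m m" "hermitian_mat A"
  shows "\<exists>ls U. dual_quat.diagonalizes m A ls U"
proof -
  let ?A0 = "std_mat A" and ?A1 = "inf_mat A"
  have A0: "?A0 \<in> carrier_mat m m" "adjoint_mat ?A0 = ?A0" and A1: "?A1 \<in> carrier_mat m m" "adjoint_mat ?A1 = ?A1"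
    using A hermitian_parts[OF A(2)] by auto
  obtain U where U: "U \<in> carrier_mat m m" "unitary_mat U"
    and M_le: "\<And>p q. p < q \<Longrightarrow> q < m \<Longrightarrow> quat_re ((adjoint_mat U * ?A0 * U) $$ (q, q)) \<le> quat_re ((adjoint_mat U * ?A0 * U) $$ (p, p))"
    and M_zero: "\<And>p q. p < q \<Longrightarrow> q < m \<Longrightarrow> (adjoint_mat U * ?A0 * U) $$ (q, p) = 0"
    and N_le: "\<And>p q. p < q \<Longrightarrow> q < m \<Longrightarrow>
      quat_re ((adjoint_mat U * ?A0 * U) $$ (q, q)) = quat_re ((adjoint_mat U * ?A0 * U) $$ (p, p)) \<Longrightarrow>
      quat_re ((adjoint_mat U * ?A1 * U) $$ (q, q)) \<le> quat_re ((adjoint_mat U * ?A1 * U) $$ (p, p)) \<and>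
      (adjoint_mat U * ?A1 * U) $$ (q, p) = 0"
    by (rule simultaneous_lex_diagonalization[OF A0 A1]) (rule that; blast)
  define M where "M = adjoint_mat U * ?A0 * U"
  define N where "N = adjoint_mat U * ?A1 * U"
  have M: "M \<in> carrier_mat m m" "adjoint_mat M = M" and N: "N \<in> carrier_mat m m" "adjoint_mat N = N"
    using adjoint_conjugation[OF A0(1) U(1) A0(2)] adjoint_conjugation[OF A1(1) U(1) A1(2)] A0 A1 U
    by (simp_all add: M_def N_def)
  define d where "d i = quat_re (M $$ (i, i))" for i
  define e where "e i = quat_re (N $$ (i, i))" for i
  have sym: "M $$ (i, j) = invol (M $$ (j, i))" "N $$ (i, j) = invol (N $$ (j, i))" if "i < m" "j < m" for i j
    using that adjoint_index[OF M(1), of i j] adjoint_index[OF N(1), of i j] M N by simp_all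
  have M_entry: "M $$ (i, j) = (if i = j then of_real (d i) else 0)" if "i < m" "j < m" for i j
  proof (cases i j rule: linorder_cases)
    case less
    then show ?thesis using that M_zero[of i j] sym(1)[of i j] by (simp add: M_def[symmetric])
  next
    case equal
    then show ?thesis using that sym(1)[of i i] self_adjoint_quat[of "M $$ (i, i)"] by (simp add: d_def)
  next
    case greater
    then show ?thesis using that M_zero[of j i] by (simp add: M_def[symmetric])
  qed
  have N_diag: "N $$ (i, i) = of_real (e i)" if "i < m" for i
    using that sym(2)[of i i] self_adjoint_quat[of "N $$ (i, i)"] by (simp add: e_def)
  have N_zero: "N $$ (i, j) = 0" if "i < m" "j < m" "i \<noteq> j" "d i = d j" for i j
  proof (cases "i < j")
    case True
    then show ?thesis using that N_le[of i j] sym(2)[of i j] by (simp add: M_def[symmetric] N_def[symmetric] d_def)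
  next
    case False
    then show ?thesis using that N_le[of j i] by (simp add: M_def[symmetric] N_def[symmetric] d_def)
  qed
  define D where "D = mat_diag m (\<lambda>i. of_real (d i) :: quat)"
  define E where "E = mat_diag m (\<lambda>i. of_real (e i) :: quat)"
  have DE: "D \<in> carrier_mat m m" "E \<in> carrier_mat m m"
    by (simp_all add: D_def E_def)
  have MD: "M = D"
    using M by (intro eq_matI) (auto simp: D_def mat_diag_def M_entry)
  \<comment> \<open>The solution of \<open>N\<^sub>i\<^sub>j + (d\<^sub>i - d\<^sub>j) P\<^sub>i\<^sub>j = 0\<close> where \<open>d\<^sub>i \<noteq> d\<^sub>j\<close>; the value 0 elsewhere keeps \<open>P\<close> skew.\<close>
  define P where "P = mat m m (\<lambda>(i, j). if d i = d j then 0 else (1 / (d j - d i)) *\<^sub>R N $$ (i, j))"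
  have P: "P \<in> carrier_mat m m" by (simp add: P_def)
  have scale: "invol (r *\<^sub>R x) = r *\<^sub>R invol x" for r and x :: quat
    by (simp add: quat_simps)
  have P_skew: "adjoint_mat P + P = 0\<^sub>m m m"
  proof (rule eq_matI)
    fix i j assume "i < dim_row (0\<^sub>m m m :: quat mat)" "j < dim_col (0\<^sub>m m m :: quat mat)"
    then have ij: "i < m" "j < m" by auto
    have "1 / (d i - d j) = - (1 / (d j - d i))"
      by (metis minus_diff_eq minus_divide_right)
    with ij show "(adjoint_mat P + P) $$ (i, j) = 0\<^sub>m m m $$ (i, j)"
      using sym(2)[OF ij] P
      by (simp add: adjoint_index[of _ m m]) (simp add: P_def scale invol_minus)
  qed (use P in auto)
  have P_skew': "P + adjoint_mat P = 0\<^sub>m m m"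
    using P_skew comm_add_mat[of P m m "adjoint_mat P"] P by simp
  \<comment> \<open>The infinitesimal part of the equation \<open>(I + P \<epsilon>) (D + E \<epsilon>) (I + P \<epsilon>)\<^sup>* = D + N \<epsilon>\<close>.\<close>
  have N_split: "D * adjoint_mat P + (E + P * D) = N"
  proof (rule eq_matI)
    fix i j assume "i < dim_row N" "j < dim_col N"
    then have ij: "i < m" "j < m" using N by auto
    have "(D * adjoint_mat P) $$ (i, j) = of_real (d i) * invol (P $$ (j, i))"
      and "(P * D) $$ (i, j) = P $$ (i, j) * of_real (d j)"
      and "E $$ (i, j) = (if i = j then of_real (e i) else 0)"
      using ij P unfolding D_def E_def
      by (simp_all add: mat_diag_mult_left[of _ m m] mat_diag_mult_right[of _ m m] adjoint_index[of _ m m]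
          mat_diag_def[of _ "\<lambda>i. of_real (e i)"] del: index_mult_mat(1))
    then have "(D * adjoint_mat P + (E + P * D)) $$ (i, j)
        = of_real (d i) * invol (P $$ (j, i)) + ((if i = j then of_real (e i) else 0) + P $$ (i, j) * of_real (d j))"
      using ij P DE by (simp del: index_mult_mat(1))
    also have "\<dots> = (if i = j then of_real (e i) else 0) + (d j - d i) *\<^sub>R P $$ (i, j)"
    proof -
      have "invol (P $$ (j, i)) = - P $$ (i, j)"
        using arg_cong[OF P_skew, of "\<lambda>X. X $$ (i, j)"] ij P
        by (simp add: adjoint_index[of _ m m] eq_neg_iff_add_eq_0)
      then show ?thesis by (simp add: of_real_quat quat_simps algebra_simps)
    qed
    also have "\<dots> = N $$ (i, j)"
      using ij N_diag[of i] N_zero[of i j] by (auto simp: P_def)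
    finally show "(D * adjoint_mat P + (E + P * D)) $$ (i, j) = N $$ (i, j)" .
  qed (use N P DE in auto)
  define V where "V = dual_mat U (U * P)"
  define ls where "ls = map (\<lambda>i. Dual (d i) (e i)) [0..<m]"
  have V: "V \<in> carrier_mat m m" using U by (simp add: V_def)
  have V_adj: "adjoint_mat V = dual_mat (adjoint_mat U) (adjoint_mat P * adjoint_mat U)"
    using U P by (simp add: V_def adjoint_dual_mat[of _ m] adjoint_mult[of _ m m _ m])
  note sq = assoc_mult_mat[of _ m m _ m _ m]
  have UU: "adjoint_mat U * U = 1\<^sub>m m" "U * adjoint_mat U = 1\<^sub>m m"
    using U by (simp_all add: unitary_iff[of _ m])
  have "adjoint_mat V * V = dual_mat (adjoint_mat U * U) (adjoint_mat U * (U * P) + adjoint_mat P * adjoint_mat U * U)"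
    unfolding V_adj unfolding V_def using U P by (simp add: dual_mat_mult[of _ m])
  also have "adjoint_mat U * (U * P) + adjoint_mat P * adjoint_mat U * U = 0\<^sub>m m m"
  proof -
    have "adjoint_mat U * (U * P) = P"
      using U P UU by (simp flip: sq)
    moreover have "adjoint_mat P * adjoint_mat U * U = adjoint_mat P"
      using U P UU by (simp add: sq right_mult_one_mat[of _ m m])
    ultimately show ?thesis using P_skew' by simp
  qed
  finally have VV: "adjoint_mat V * V = 1\<^sub>m m"
    by (simp add: UU dual_mat_one)
  have "V * adjoint_mat V = dual_mat (U * adjoint_mat U) (U * (adjoint_mat P * adjoint_mat U) + U * P * adjoint_mat U)"
    unfolding V_adj unfolding V_def using U P by (simp add: dual_mat_mult[of _ m])
  also have "U * (adjoint_mat P * adjoint_mat U) + U * P * adjoint_mat U = U * (adjoint_mat P + P) * adjoint_mat U"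
    using U P by (simp add: sq add_mult_distrib_mat[of _ m m _ _ m] mult_add_distrib_mat[of _ m m _ m])
  also have "\<dots> = 0\<^sub>m m m"
    using U by (simp add: P_skew right_mult_zero_mat[of _ m m] left_mult_zero_mat[of _ m m])
  finally have VV': "V * adjoint_mat V = 1\<^sub>m m"
    by (simp add: UU dual_mat_one)
  have diag: "mat_diag m (\<lambda>i. quat_of_dual (ls ! i)) = dual_mat D E"
    by (intro eq_matI) (auto simp: mat_diag_def D_def E_def dual_mat_def ls_def quat_of_dual_def zero_dual_def)
  have "V * dual_mat D E * adjoint_mat V
      = dual_mat (U * D * adjoint_mat U)
          (U * D * (adjoint_mat P * adjoint_mat U) + (U * E + U * P * D) * adjoint_mat U)"
    unfolding V_adj unfolding V_def using U P DE by (simp add: dual_mat_mult[of _ m])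
  also have "U * D * (adjoint_mat P * adjoint_mat U) + (U * E + U * P * D) * adjoint_mat U
      = U * (D * adjoint_mat P + (E + P * D)) * adjoint_mat U"
    using U P DE by (simp add: sq add_mult_distrib_mat[of _ m m _ _ m] mult_add_distrib_mat[of _ m m _ m])
  also have "\<dots> = ?A1"
    unfolding N_split unfolding N_def using conjugation_cancel[OF A1(1) U] .
  also have "U * D * adjoint_mat U = ?A0"
    unfolding MD[symmetric] unfolding M_def using conjugation_cancel[OF A0(1) U] .
  finally have "A = V * mat_diag m (\<lambda>i. quat_of_dual (ls ! i)) * adjoint_mat V"
    by (simp add: diag dual_mat_std_inf)
  moreover have "sorted_wrt (\<ge>) ls"
    using M_le N_le
    by (auto simp: sorted_wrt_iff_nth_less ls_def less_eq_dual_def less_dual_def d_def e_def M_def N_def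
        order.order_iff_strict)
  ultimately have "dual_quat.diagonalizes m A ls V"
    using V VV VV' by (simp add: dual_quat.diagonalizes_def unitary_iff[of _ m] ls_def)
  then show ?thesis by blast
qed

lemma std_mat_mult:
  fixes A B :: "'a::ring_1 dual mat"
  assumes "A \<in> carrier_mat m m" "B \<in> carrier_mat m m"
  shows "std_mat (A * B) = std_mat A * std_mat B"
proof (rule eq_matI)
  fix i j assume "i < dim_row (std_mat A * std_mat B)" "j < dim_col (std_mat A * std_mat B)"
  then have "i < m" "j < m" using assms by (auto simp: std_mat_def)
  then show "std_mat (A * B) $$ (i, j) = (std_mat A * std_mat B) $$ (i, j)"
    using assms
    by (simp add: index_mult_mat_sum[of _ m m _ m] del: index_mult_mat(1))
      (simp add: std_mat_def index_mult_mat_sum[of _ m m _ m] std_part_sum times_dual_def del: index_mult_mat(1))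
qed (use assms in \<open>auto simp: std_mat_def\<close>)

lemma std_mat_adjoint: "std_mat (adjoint_mat A) = adjoint_mat (std_mat A)"
  by (intro eq_matI) (auto simp: std_mat_def adjoint_mat_def invol_dual_def)

lemma std_mat_one: "std_mat (1\<^sub>m m) = 1\<^sub>m m"
  by (intro eq_matI) (auto simp: std_mat_def one_dual_def zero_dual_def)

text \<open>
  Taking standard parts is a homomorphism of rings with involution and preserves the weak order, so it
  carries a decomposition of \<open>A + 0 \<epsilon>\<close> to one of \<open>A\<close>.
\<close>
lemma quat_spectral_decomposition:
  assumes A: "A \<in> carrier_mat m m" "hermitian_mat A"
  shows "\<exists>ls U. quat.diagonalizes m A ls U"
proof -
  define B where "B = dual_mat A (0\<^sub>m m m)"
  have B: "B \<in> carrier_mat m m" "hermitian_mat B"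
  proof -
    show "B \<in> carrier_mat m m" using A by (simp add: B_def)
    have "adjoint_mat (0\<^sub>m m m :: quat mat) = 0\<^sub>m m m"
      by (intro eq_matI) (auto simp: adjoint_mat_def)
    then have "adjoint_mat B = B"
      using A hermitianD[OF A(2)] by (simp add: B_def adjoint_dual_mat[of _ m])
    then show "hermitian_mat B"
      using \<open>B \<in> carrier_mat m m\<close> by (simp add: hermitian_mat_def)
  qed
  have AB: "A = std_mat B"
    using A by (intro eq_matI) (auto simp: B_def std_mat_def dual_mat_def)
  obtain ls U where "dual_quat.diagonalizes m B ls U"
    using dual_quat_spectral_decomposition[OF B] by blast
  then have U: "length ls = m" "sorted_wrt (\<ge>) ls" "U \<in> carrier_mat m m" "unitary_mat U"
    and eq: "B = U * mat_diag m (\<lambda>i. quat_of_dual (ls ! i)) * adjoint_mat U"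
    by (auto simp: dual_quat.diagonalizes_def)
  let ?ls = "map std_part ls"
  have diag: "std_mat (mat_diag m (\<lambda>i. quat_of_dual (ls ! i))) = mat_diag m (\<lambda>i. of_real (?ls ! i))"
    using U(1) by (intro eq_matI) (auto simp: std_mat_def mat_diag_def quat_of_dual_def zero_dual_def)
  have "std_mat (adjoint_mat U * U) = 1\<^sub>m m" "std_mat (U * adjoint_mat U) = 1\<^sub>m m"
    using U by (simp_all add: unitary_iff[of _ m] std_mat_one)
  then have unitary: "unitary_mat (std_mat U)"
    using U by (simp add: unitary_iff[of _ m] std_mat_mult[of _ m] std_mat_adjoint)
  have "A = std_mat U * mat_diag m (\<lambda>i. of_real (?ls ! i)) * adjoint_mat (std_mat U)"
    using U unfolding AB eq by (simp add: std_mat_mult[of _ m] std_mat_adjoint diag)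
  moreover have "sorted_wrt (\<ge>) ?ls"
    using U(2) unfolding sorted_wrt_map
    by (rule sorted_wrt_mono_rel[rotated]) (auto simp: less_eq_dual_def less_dual_def)
  ultimately have "quat.diagonalizes m A ?ls (std_mat U)"
    using U unitary by (simp add: quat.diagonalizes_def)
  then show ?thesis by blast
qed


section \<open>The trace inequality\<close>

theorem theorem4p6:
  fixes m :: nat
  shows "(\<forall>A B :: quat dual mat.
      A \<in> carrier_mat m m \<longrightarrow> B \<in> carrier_mat m m \<longrightarrow> hermitian_mat A \<longrightarrow> hermitian_mat B \<longrightarrow>
      (\<exists>t :: real dual. trace_mat (A * B + B * A) = quat_of_dual t \<and>
         t \<le> 2 * (\<Sum>i<m. dual_quat_eigvals A ! i * dual_quat_eigvals B ! i)))
    \<and> (\<forall>A B :: quat mat.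
      A \<in> carrier_mat m m \<longrightarrow> B \<in> carrier_mat m m \<longrightarrow> hermitian_mat A \<longrightarrow> hermitian_mat B \<longrightarrow>
      (\<exists>t :: real. trace_mat (A * B + B * A) = of_real t \<and>
         t \<le> 2 * (\<Sum>i<m. quat_eigvals A ! i * quat_eigvals B ! i)))"
proof (intro conjI allI impI)
  fix A B :: "quat dual mat"
  assume A: "A \<in> carrier_mat m m" and B: "B \<in> carrier_mat m m"
    and hA: "hermitian_mat A" and hB: "hermitian_mat B"
  obtain ls U ms V where "dual_quat.diagonalizes m A ls U" "dual_quat.diagonalizes m B ms V"
    using dual_quat_spectral_decomposition[OF A hA] dual_quat_spectral_decomposition[OF B hB] by blast
  then show "\<exists>t. trace_mat (A * B + B * A) = quat_of_dual t \<and>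
      t \<le> 2 * (\<Sum>i<m. dual_quat_eigvals A ! i * dual_quat_eigvals B ! i)"
    by (rule dual_quat.trace_anticommutator_le[OF A hA B hB])
next
  fix A B :: "quat mat"
  assume A: "A \<in> carrier_mat m m" and B: "B \<in> carrier_mat m m"
    and hA: "hermitian_mat A" and hB: "hermitian_mat B"
  obtain ls U ms V where "quat.diagonalizes m A ls U" "quat.diagonalizes m B ms V"
    using quat_spectral_decomposition[OF A hA] quat_spectral_decomposition[OF B hB] by blast
  then show "\<exists>t. trace_mat (A * B + B * A) = of_real t \<and>
      t \<le> 2 * (\<Sum>i<m. quat_eigvals A ! i * quat_eigvals B ! i)"
    by (rule quat.trace_anticommutator_le[OF A hA B hB])
qed

end
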